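(* Let $p>1$ and let $X$ be a closed connected surface with a triangulation $\mathcal{T}=(V,E,F)$, $N=|V|$, and a weight $\Phi:E\to[0,\pi/2]$. For any initial circle packing metric $r(0)\in\mathbb{R}^N_{>0}$ satisfying $\prod_{i=1}^N r_i(0)=1$, the solution $r(t)$ to the combinatorial $p$-th Calabi flow in Euclidean background geometry, $$\frac{dr_i}{dt}=(\Delta_pK_i)\,r_i,\qquad i=1,\dots,N,$$ with initial value $r(0)$, exists for all $t\in[0,+\infty)$. Additionally, $r(t)$ converges as $t\to+\infty$ if and only if there exists a constant curvature circle packing metric $r_{av}$ (in Euclidean background geometry) on $(X,\mathcal{T},\Phi)$.
   Context: Setting: $X$ is a closed surface with a triangulation $\mathcal{T}=(V,E,F)$ (vertices, edges, faces), $V=\{v_1,\dots,v_N\}$, and weight $\Phi:E\to[0,\pi/2]$, $\Phi_{ij}=\Phi(\{i,j\})$. Write $j\sim i$ if $v_i,v_j$ are adjacent. A circle packing metric is a positive function $r:V\to(0,+\infty)$, $v_i\mapsto r_i$, regarded as a point $r\in\mathbb{R}^N_{>0}$. In Euclidean background geometry, $r$ assigns to each edge $\{i,j\}\in E$ the length $l_{ij}=\sqrt{r_i^2+r_j^2+2r_ir_j\cos\Phi_{ij}}$; for each face $\{i,j,k\}\in F$ the three lengths satisfy the triangle inequalities, so the face is a Euclidean triangle. Let $\theta_i^{jk}$ be the inner angle at $v_i$ in the triangle $\{i,j,k\}$. The combinatorial Gauss curvature at $v_i$ is $K_i=2\pi-\sum_{\{i,j,k\}\in F}\theta_i^{jk}$,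 the sum being over all faces having $v_i$ as a vertex. A constant curvature circle packing metric $r_{av}$ is a circle packing metric with $K_i=k_{av}:=2\pi\chi(X)/N$ for all $i$. For an edge $\{i,j\}$, let $k,l$ be the two vertices such that $\{i,j,k\},\{i,j,l\}$ are the two faces containing the edge, and set $$B_{ij}=\frac{\partial(\theta_i^{jk}+\theta_i^{jl})}{\partial r_j}\,r_j .$$ The discrete $p$-Laplace operator is, for $f\in\mathbb{R}^N$, $$\Delta_pf_i=\sum_{j\sim i}B_{ij}|f_j-f_i|^{p-2}(f_j-f_i),$$ where $|x|^{p-2}x$ is read as $0$ when $x=0$. In the flow, $K_i$ and $B_{ij}$ are evaluated at $r(t)$. *)

theory Defs
  imports "HOL-Analysis.Analysis"
begin

section \<open>Triangulated closed surfaces\<close>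

definition closed_surface :: "'a topology \<Rightarrow> bool" where
  "closed_surface X \<longleftrightarrow>
     compact_space X \<and> Hausdorff_space X \<and> second_countable X \<and>
     (\<forall>x\<in>topspace X. \<exists>U (S :: (real^2) set).
        openin X U \<and> x \<in> U \<and> open S \<and> subtopology X U homeomorphic_space top_of_set S)"

text \<open>
  The vertex set is the finite type \<open>'v\<close>, so that \<open>N = CARD('v)\<close> and \<open>real^'v\<close> is \<open>\<real>\<^sup>N\<close>.
  Edges and faces are sets of two, respectively three, vertices.
\<close>

definition two_complex :: "'v::finite set set \<Rightarrow> 'v set set \<Rightarrow> bool" where
  "two_complex E F \<longleftrightarrow>
     (\<forall>e\<in>E. card e = 2) \<and> (\<forall>f\<in>F. card f = 3) \<and> (\<forall>f\<in>F. \<forall>e\<subseteq>f. card e = 2 \<longrightarrow> e \<in> E)"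

text \<open>The geometric realization, in barycentric coordinates.\<close>

definition realization :: "'v::finite set set \<Rightarrow> 'v set set \<Rightarrow> (real^'v) set" where
  "realization E F =
     {x. (\<forall>v. 0 \<le> x $ v) \<and> (\<Sum>v\<in>UNIV. x $ v) = 1 \<and>
         {v. x $ v \<noteq> 0} \<in> range (\<lambda>v. {v}) \<union> E \<union> F}"

definition triangulation_of :: "'a topology \<Rightarrow> 'v::finite set set \<Rightarrow> 'v set set \<Rightarrow> bool" where
  "triangulation_of X E F \<longleftrightarrow>
     two_complex E F \<and> X homeomorphic_space top_of_set (realization E F)"

definition euler_characteristic :: "'v::finite set set \<Rightarrow> 'v set set \<Rightarrow> int" where
  "euler_characteristic E F = int CARD('v) - int (card E) + int (card F)"

section \<open>Circle packing metrics and curvature\<close>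

definition circle_packing_metric :: "real^'v \<Rightarrow> bool" where
  "circle_packing_metric r \<longleftrightarrow> (\<forall>i. 0 < r $ i)"

definition edge_length :: "('v set \<Rightarrow> real) \<Rightarrow> real^'v \<Rightarrow> 'v \<Rightarrow> 'v \<Rightarrow> real" where
  "edge_length \<Phi> r i j = sqrt ((r $ i)\<^sup>2 + (r $ j)\<^sup>2 + 2 * r $ i * r $ j * cos (\<Phi> {i, j}))"

lemma edge_length_triangle:
  assumes r: "circle_packing_metric r"
    and "cos (\<Phi> {i, j}) \<ge> 0" "cos (\<Phi> {i, k}) \<ge> 0" "cos (\<Phi> {j, k}) \<ge> 0"
  shows "edge_length \<Phi> r i j < edge_length \<Phi> r i k + edge_length \<Phi> r j k"
proof -
  have pos: "r $ v > 0" for v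
    using r by (simp add: circle_packing_metric_def)
  have lower: "r $ u < edge_length \<Phi> r u k" if "cos (\<Phi> {u, k}) \<ge> 0" for u
  proof -
    have "0 \<le> 2 * r $ u * r $ k * cos (\<Phi> {u, k})"
      using that pos[of u] pos[of k] by simp
    then show ?thesis
      unfolding edge_length_def using pos[of k] by (intro real_less_rsqrt) (auto simp: add_pos_nonneg)
  qed
  have "r $ i * r $ j * cos (\<Phi> {i, j}) \<le> r $ i * r $ j"
    using pos[of i] pos[of j] by (simp add: mult_left_le)
  then have "edge_length \<Phi> r i j \<le> r $ i + r $ j"
    unfolding edge_length_def using pos[of i] pos[of j]
    by (intro real_le_lsqrt) (auto simp: power2_sum)
  with lower[of i] lower[of j] assms show ?thesis
    by linarith
qed

text \<open>
  \<open>inner_angle a b c\<close> is the angle, in a Euclidean triangle with side lengths \<open>a\<close>, \<open>b\<close>, \<open>c\<close>,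
  between the sides of length \<open>a\<close> and \<open>b\<close> (law of cosines).
\<close>

definition inner_angle :: "real \<Rightarrow> real \<Rightarrow> real \<Rightarrow> real" where
  "inner_angle a b c = arccos ((a\<^sup>2 + b\<^sup>2 - c\<^sup>2) / (2 * a * b))"

lemma inner_angle_eq:
  fixes A B C :: "'a::real_inner"
  shows "inner_angle (dist A B) (dist A C) (dist B C) =
         arccos (((B - A) \<bullet> (C - A)) / (norm (B - A) * norm (C - A)))"
proof -
  have "(dist A B)\<^sup>2 + (dist A C)\<^sup>2 - (dist B C)\<^sup>2 = 2 * ((B - A) \<bullet> (C - A))"
    by (simp add: dist_norm power2_norm_eq_inner inner_diff inner_commute)
  moreover have "dist A B = norm (B - A)" "dist A C = norm (C - A)"
    by (simp_all add: dist_norm norm_minus_commute)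
  ultimately show ?thesis
    by (simp add: inner_angle_def)
qed

text \<open>\<open>angle \<Phi> r i j k\<close> is \<open>\<theta>\<^sub>i\<^sup>j\<^sup>k\<close>, the angle at \<open>i\<close> in the triangle \<open>{i, j, k}\<close>.\<close>

definition angle :: "('v set \<Rightarrow> real) \<Rightarrow> real^'v \<Rightarrow> 'v \<Rightarrow> 'v \<Rightarrow> 'v \<Rightarrow> real" where
  "angle \<Phi> r i j k =
     inner_angle (edge_length \<Phi> r i j) (edge_length \<Phi> r i k) (edge_length \<Phi> r j k)"

definition face_angle :: "('v set \<Rightarrow> real) \<Rightarrow> real^'v \<Rightarrow> 'v set \<Rightarrow> 'v \<Rightarrow> real" where
  "face_angle \<Phi> r f i =
     (THE \<theta>. \<exists>j k. f = {i, j, k} \<and> card f = 3 \<and> \<theta> = angle \<Phi> r i j k)"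

lemma face_angle_eq:
  assumes "card {i, j, k} = 3"
  shows "face_angle \<Phi> r {i, j, k} i = angle \<Phi> r i j k"
  unfolding face_angle_def
proof (rule the_equality)
  show "\<exists>j' k'. {i, j, k} = {i, j', k'} \<and> card {i, j, k} = 3 \<and> angle \<Phi> r i j k = angle \<Phi> r i j' k'"
    using assms by blast
next
  fix \<theta>
  assume "\<exists>j' k'. {i, j, k} = {i, j', k'} \<and> card {i, j, k} = 3 \<and> \<theta> = angle \<Phi> r i j' k'"
  then obtain j' k' where eq: "{i, j, k} = {i, j', k'}" and \<theta>: "\<theta> = angle \<Phi> r i j' k'"
    by blast
  have "i \<noteq> j" "i \<noteq> k" "j \<noteq> k"
    using assms by (auto simp: card_insert_if split: if_splits)
  moreover have "j \<in> {i, j', k'}" "k \<in> {i, j', k'}"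
    using eq by blast+
  ultimately have "(j' = j \<and> k' = k) \<or> (j' = k \<and> k' = j)"
    by auto
  moreover have "angle \<Phi> r i k j = angle \<Phi> r i j k"
    by (simp add: angle_def inner_angle_def edge_length_def insert_commute algebra_simps)
  ultimately show "\<theta> = angle \<Phi> r i j k"
    using \<theta> by auto
qed

definition curvature :: "'v::finite set set \<Rightarrow> ('v set \<Rightarrow> real) \<Rightarrow> real^'v \<Rightarrow> real^'v" where
  "curvature F \<Phi> r = (\<chi> i. 2 * pi - (\<Sum>f | f \<in> F \<and> i \<in> f. face_angle \<Phi> r f i))"

definition constant_curvature_metric ::
    "'v::finite set set \<Rightarrow> 'v set set \<Rightarrow> ('v set \<Rightarrow> real) \<Rightarrow> real^'v \<Rightarrow> bool" where
  "constant_curvature_metric E F \<Phi> r \<longleftrightarrow>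
     circle_packing_metric r \<and>
     (\<forall>i. curvature F \<Phi> r $ i = 2 * pi * real_of_int (euler_characteristic E F) / real CARD('v))"

section \<open>The combinatorial \<open>p\<close>-th Calabi flow\<close>

text \<open>
  \<open>B\<^sub>i\<^sub>j\<close>: the vertices \<open>k\<close> with \<open>{i, j, k} \<in> F\<close> are those opposite to the edge \<open>{i, j}\<close>
  (on a closed surface there are exactly two), and \<open>deriv\<close> is taken in the variable \<open>r\<^sub>j\<close> alone.
\<close>

definition B_coeff ::
    "'v::finite set set \<Rightarrow> ('v set \<Rightarrow> real) \<Rightarrow> real^'v \<Rightarrow> 'v \<Rightarrow> 'v \<Rightarrow> real" where
  "B_coeff F \<Phi> r i j =
     deriv (\<lambda>s. \<Sum>k | {i, j, k} \<in> F. angle \<Phi> (\<chi> m. if m = j then s else r $ m) i j k) (r $ j) * r $ j"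

text \<open>For \<open>x = 0\<close> the term \<open>\<bar>x\<bar> powr (p - 2) * x\<close> is \<open>0\<close>, as required.\<close>

definition p_laplace ::
    "real \<Rightarrow> 'v::finite set set \<Rightarrow> 'v set set \<Rightarrow> ('v set \<Rightarrow> real) \<Rightarrow> real^'v \<Rightarrow> real^'v \<Rightarrow> real^'v" where
  "p_laplace p E F \<Phi> r f =
     (\<chi> i. \<Sum>j | {i, j} \<in> E. B_coeff F \<Phi> r i j * (\<bar>f $ j - f $ i\<bar> powr (p - 2) * (f $ j - f $ i)))"

definition p_calabi_flow ::
    "real \<Rightarrow> 'v::finite set set \<Rightarrow> 'v set set \<Rightarrow> ('v set \<Rightarrow> real) \<Rightarrow> real set \<Rightarrow> (real \<Rightarrow> real^'v) \<Rightarrow> bool" where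
  "p_calabi_flow p E F \<Phi> I r \<longleftrightarrow>
     (\<forall>t\<in>I. circle_packing_metric (r t) \<and>
        (r has_vector_derivative (\<chi> i. p_laplace p E F \<Phi> (r t) (curvature F \<Phi> (r t)) $ i * r t $ i))
          (at t within I))"

end

theory Submission
  imports Defs "HOL-Complex_Analysis.Great_Picard"
begin

text \<open>
  In the coordinates \<open>u\<^sub>i = ln r\<^sub>i\<close> the flow is the autonomous system
  \<open>u\<^sub>i' = \<Sum>\<^sub>j B\<^sub>i\<^sub>j |K\<^sub>j - K\<^sub>i|\<^sup>p\<^sup>-\<^sup>2 (K\<^sub>j - K\<^sub>i)\<close>. A computation in a single triangle
  (\<open>corner_has_derivative\<close>) shows that \<open>B\<close> is symmetric and nonnegative and that the derivative of the
  curvature is the weighted graph Laplacian \<open>dK\<^sub>i = \<Sum>\<^sub>j B\<^sub>i\<^sub>j (du\<^sub>i - du\<^sub>j)\<close>. Some entries \<open>B\<^sub>i\<^sub>j\<close> of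
  edges may vanish, but the edges with positive entries still connect all vertices
  (\<open>conductance_connected\<close>).

  Existence: the curvature is bounded, and so is \<open>B\<close> uniformly in all metrics (\<open>edge_weight_le\<close>). The
  right-hand side is therefore a bounded continuous vector field on \<open>\<real>\<^sup>N\<close>. For \<open>p < 2\<close> it need not be
  Lipschitz, so solutions come from Peano's theorem (\<open>peano_existence_bounded\<close>); boundedness
  makes them global, and every solution on a bounded interval extends (\<open>ode_continuation\<close>).

  Convergence: since \<open>dK\<close> is symmetric and positive semidefinite, \<open>K - k\<close> is the gradient of a convex
  energy (\<open>energy_deriv\<close>), which decreases along the flow at the rate
  \<open>1/2 \<Sum> B\<^sub>i\<^sub>j |K\<^sub>j - K\<^sub>i|\<^sup>p\<close>. This dissipation vanishes only if \<open>K\<close> is constant. Hence a limit of the flow has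
  constant curvature, and the value of the constant is \<open>2\<pi>\<chi>/N\<close> by the Gauss-Bonnet formula
  (\<open>sum_curvature\<close>). Conversely, if a metric of constant curvature exists, it is, up to scaling, the unique
  critical point of the energy; the energy grows linearly away from it on the hyperplane
  \<open>\<Sum> u\<^sub>i = 0\<close> that the flow preserves (\<open>energy_linear_growth\<close>), and LaSalle's argument gives convergence.

  The Gauss-Bonnet formula needs that every edge lies in exactly two faces, and the connectedness that it
  lies in at least one. This is derived from the hypothesis that the realization is a surface by means of
  invariance of domain (\<open>two_faces_at_edge\<close>).
\<close>

section \<open>Ordinary differential equations with bounded continuous right-hand side\<close>

fun euler_step :: "('a::real_vector \<Rightarrow> 'a) \<Rightarrow> 'a \<Rightarrow> real \<Rightarrow> nat \<Rightarrow> 'a" where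
  "euler_step g x0 h 0 = x0"
| "euler_step g x0 h (Suc m) = euler_step g x0 h m + h *\<^sub>R g (euler_step g x0 h m)"

text \<open>
  With \<open>v = 0\<close> this is the Lipschitz bound for Euler polygons; with \<open>v\<close> the value of the field at a
  point that the steps stay close to, it becomes the differential equation in the limit.
\<close>

lemma euler_step_increment:
  fixes g :: "'a::real_normed_vector \<Rightarrow> 'a"
  assumes "a \<le> b" "h \<ge> 0"
    and "\<And>m. a \<le> m \<Longrightarrow> m < b \<Longrightarrow> norm (g (euler_step g x0 h m) - v) \<le> e"
  shows "norm (euler_step g x0 h b - euler_step g x0 h a - (h * (real b - real a)) *\<^sub>R v) \<le> h * (real b - real a) * e"
  using assms(1,3)
proof (induction b rule: dec_induct)
  case base
  then show ?case by simp
next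
  case (step n)
  let ?Y = "euler_step g x0 h"
  have "?Y (Suc n) - ?Y a - (h * (real (Suc n) - real a)) *\<^sub>R v
      = (?Y n - ?Y a - (h * (real n - real a)) *\<^sub>R v) + h *\<^sub>R (g (?Y n) - v)"
    by (simp add: algebra_simps)
  also have "norm \<dots> \<le> h * (real n - real a) * e + h * e"
    using step assms(2) by (intro norm_triangle_mono) (auto intro!: mult_left_mono)
  finally show ?case by (simp add: algebra_simps)
qed

lemma euler_index_diff:
  fixes s t c :: real
  assumes "0 \<le> s" "s \<le> t" "c > 0"
  shows "nat \<lfloor>s * c\<rfloor> \<le> nat \<lfloor>t * c\<rfloor>"
    and "\<bar>(real (nat \<lfloor>t * c\<rfloor>) - real (nat \<lfloor>s * c\<rfloor>)) / c - (t - s)\<bar> \<le> 1 / c"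
proof -
  have st: "s * c \<le> t * c" "0 \<le> s * c" "0 \<le> t * c" using assms by auto
  then show "nat \<lfloor>s * c\<rfloor> \<le> nat \<lfloor>t * c\<rfloor>"
    by (intro nat_mono floor_mono)
  have *: "real (nat \<lfloor>x\<rfloor>) \<le> x \<and> x < real (nat \<lfloor>x\<rfloor>) + 1" if "x \<ge> 0" for x :: real
    using that by (simp add: floor_correct)
  have "\<bar>(real (nat \<lfloor>t * c\<rfloor>) - real (nat \<lfloor>s * c\<rfloor>)) - (t - s) * c\<bar> \<le> 1"
    using *[OF st(2)] *[OF st(3)] unfolding left_diff_distrib by linarith
  then have "\<bar>(real (nat \<lfloor>t * c\<rfloor>) - real (nat \<lfloor>s * c\<rfloor>)) - (t - s) * c\<bar> / c \<le> 1 / c"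
    using assms by (intro divide_right_mono) auto
  also have "\<bar>(real (nat \<lfloor>t * c\<rfloor>) - real (nat \<lfloor>s * c\<rfloor>)) - (t - s) * c\<bar> / c
      = \<bar>((real (nat \<lfloor>t * c\<rfloor>) - real (nat \<lfloor>s * c\<rfloor>)) - (t - s) * c) / c\<bar>"
    using assms by (simp add: abs_divide)
  finally show "\<bar>(real (nat \<lfloor>t * c\<rfloor>) - real (nat \<lfloor>s * c\<rfloor>)) / c - (t - s)\<bar> \<le> 1 / c"
    using assms by (simp add: diff_divide_distrib)
qed

text \<open>
  Peano's theorem. Continuity of \<open>g\<close> alone gives no contraction, so the solution is a limit of Euler
  polygons along a subsequence. A diagonal argument makes the polygons converge at rational times,
  and their common Lipschitz constant \<open>M\<close> extends the convergence to all times. The bound on \<open>g\<close> rules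
  out blow-up, so the solution lives on the whole half-line. The polygons are used as step functions:
  their jumps, at most \<open>M\<close> times the step size, vanish in the limit.
\<close>

theorem peano_existence_bounded:
  fixes g :: "'a::euclidean_space \<Rightarrow> 'a"
  assumes cont: "continuous_on UNIV g" and bdd: "\<And>x. norm (g x) \<le> M"
  shows "\<exists>u. u 0 = x0 \<and> (\<forall>t\<ge>0. (u has_vector_derivative g (u t)) (at t within {0..}))"
proof -
  have M0: "M \<ge> 0" using bdd[of 0] norm_ge_zero order_trans by blast
  define z where "z n t = euler_step g x0 (1 / real (Suc n)) (nat \<lfloor>t * real (Suc n)\<rfloor>)" for n t
  \<comment> \<open>The first grid point used between \<open>s\<close> and \<open>t\<close> can lie one step to the left of \<open>s\<close>.\<close>
  have inc: "norm (z n t - z n s - (t - s) *\<^sub>R v) \<le> (t - s) * e + (e + norm v) / real (Suc n)"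
    if st: "0 \<le> s" "s \<le> t"
      and e: "e \<ge> 0" "\<And>\<tau>. s \<le> \<tau> + 1 / real (Suc n) \<Longrightarrow> \<tau> \<le> t \<Longrightarrow> 0 \<le> \<tau> \<Longrightarrow> norm (g (z n \<tau>) - v) \<le> e"
    for n s t v e
  proof -
    let ?c = "real (Suc n)"
    let ?Y = "euler_step g x0 (1 / ?c)"
    define a b where "a = nat \<lfloor>s * ?c\<rfloor>" and "b = nat \<lfloor>t * ?c\<rfloor>"
    define d where "d = 1 / ?c * (real b - real a)"
    have ab: "a \<le> b" and "\<bar>(real b - real a) / ?c - (t - s)\<bar> \<le> 1 / ?c"
      using euler_index_diff[OF st, of ?c] by (auto simp: a_def b_def)
    then have d: "\<bar>d - (t - s)\<bar> \<le> 1 / ?c" by (simp add: d_def)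
    have "norm (?Y b - ?Y a - d *\<^sub>R v) \<le> d * e"
      unfolding d_def
    proof (rule euler_step_increment[OF ab])
      fix m assume m: "a \<le> m" "m < b"
      have zm: "z n (real m / ?c) = ?Y m" by (simp add: z_def)
      have "real m + 1 \<le> real b" using m by simp
      also have "real b \<le> t * ?c" unfolding b_def using st
        by (intro of_nat_floor) (auto intro!: mult_nonneg_nonneg)
      finally have 1: "real m / ?c \<le> t" by (simp add: field_simps)
      have "s * ?c < real a + 1" using floor_correct[of "s * ?c"] unfolding a_def by linarith
      also have "\<dots> \<le> real m + 1" using m by simp
      finally have 2: "s \<le> real m / ?c + 1 / ?c" by (simp add: field_simps)
      show "norm (g (?Y m) - v) \<le> e"
        using e(2)[OF 2 1] unfolding zm by simp
    qed simp
    moreover have "norm (z n t - z n s - (t - s) *\<^sub>R v) \<le> norm (?Y b - ?Y a - d *\<^sub>R v) + norm ((d - (t - s)) *\<^sub>R v)"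
      by (rule order_trans[OF _ norm_triangle_ineq]) (simp add: z_def a_def b_def algebra_simps)
    moreover have "norm ((d - (t - s)) *\<^sub>R v) \<le> 1 / ?c * norm v"
      unfolding norm_scaleR real_norm_def by (intro mult_right_mono d norm_ge_zero)
    moreover have "d * e \<le> (t - s + 1 / ?c) * e"
      using d e(1) by (intro mult_right_mono) auto
    ultimately have "norm (z n t - z n s - (t - s) *\<^sub>R v) \<le> (t - s + 1 / ?c) * e + 1 / ?c * norm v"
      by linarith
    also have "\<dots> = (t - s) * e + (e + norm v) / ?c" by (simp add: add_divide_distrib distrib_right)
    finally show ?thesis .
  qed
  have lip0: "norm (z n t - z n s) \<le> M * (t - s) + M / real (Suc n)" if "0 \<le> s" "s \<le> t" for n s t
    using inc[OF that M0, of n 0] bdd by (simp add: mult.commute)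
  have lip: "norm (z n t - z n s) \<le> M * \<bar>t - s\<bar> + M / real (Suc n)" if "0 \<le> s" "0 \<le> t" for n s t
    using lip0[of s t n] lip0[of t s n] that by (cases "s \<le> t") (auto simp: norm_minus_commute)
  have z0: "z n 0 = x0" for n by (simp add: z_def)
  \<comment> \<open>The approximations grow linearly; after division by \<open>1 + t\<close> they are uniformly bounded.\<close>
  have bd: "norm (z n t /\<^sub>R (1 + t)) \<le> norm x0 + M" if "t \<in> \<rat> \<inter> {0..}" for n t
  proof -
    have t: "t \<ge> 0" using that by auto
    have "norm (z n t) \<le> norm x0 + (M * t + M / real (Suc n))"
      using lip[of 0 t n] t norm_triangle_ineq2[of "z n t" x0] by (simp add: z0)
    also have "M / real (Suc n) \<le> M" using M0 by (simp add: divide_le_eq mult_left_mono[of 1 _ M, simplified])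
    also have "norm x0 + (M * t + M) \<le> (norm x0 + M) * (1 + t)" using t by (simp add: algebra_simps)
    finally have "norm (z n t) \<le> (norm x0 + M) * (1 + t)" by simp
    then show ?thesis using t by (simp add: field_simps)
  qed
  have "countable (\<rat> \<inter> {0::real..})" using countable_rat by blast
  then obtain k where k: "strict_mono k"
    and kc: "\<And>t. t \<in> \<rat> \<inter> {0..} \<Longrightarrow> \<exists>l. (\<lambda>n. z (k n) t /\<^sub>R (1 + t)) \<longlonglongrightarrow> l"
    by (rule function_convergent_subsequence[where f="\<lambda>n t. z n t /\<^sub>R (1 + t)" and M="norm x0 + M"])
       (use bd in auto)
  have klarge: "(\<lambda>n. C / real (Suc (k n))) \<longlonglongrightarrow> 0" for C
  proof -
    have "filterlim (\<lambda>n. Suc (k n)) at_top sequentially"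
      using k filterlim_subseq filterlim_Suc filterlim_compose by blast
    then have "filterlim (\<lambda>n. real (Suc (k n))) at_top sequentially"
      using filterlim_compose[OF filterlim_real_sequentially] by blast
    then show ?thesis
      by (intro tendsto_divide_0[OF tendsto_const] filterlim_at_top_imp_at_infinity)
  qed
  have conv: "convergent (\<lambda>n. z (k n) t)" if t: "t \<ge> 0" for t
  proof (rule Cauchy_convergent, rule metric_CauchyI)
    fix e :: real assume e: "e > 0"
    define d where "d = e / (4 * (M + 1))"
    have d: "d > 0" using e M0 by (simp add: d_def)
    obtain q where q: "q \<in> \<rat>" "t < q" "q < t + d" using Rats_dense_in_real[of t "t + d"] d by auto
    have "q \<in> \<rat> \<inter> {0..}" using q t by auto
    from kc[OF this] obtain l where "(\<lambda>n. z (k n) q /\<^sub>R (1 + q)) \<longlonglongrightarrow> l" by blast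
    from tendsto_scaleR[OF tendsto_const[of "1 + q"] this] have "(\<lambda>n. z (k n) q) \<longlonglongrightarrow> (1 + q) *\<^sub>R l"
      using q t by simp
    then have "Cauchy (\<lambda>n. z (k n) q)" using LIMSEQ_imp_Cauchy by blast
    then obtain N1 where N1: "\<And>m n. m \<ge> N1 \<Longrightarrow> n \<ge> N1 \<Longrightarrow> dist (z (k m) q) (z (k n) q) < e / 4"
      using e unfolding Cauchy_def by (metis divide_pos_pos zero_less_numeral)
    have "\<forall>\<^sub>F n in sequentially. M / real (Suc (k n)) < e / 8"
      using klarge[of M] e by (intro order_tendstoD) auto
    then obtain N2 where N2: "\<And>n. n \<ge> N2 \<Longrightarrow> M / real (Suc (k n)) < e / 8"
      unfolding eventually_sequentially by blast
    have "M * d \<le> e / 4" using M0 e by (simp add: d_def field_simps)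
    then have Mq: "M * \<bar>t - q\<bar> \<le> e / 4"
      using mult_left_mono[of "q - t" d M] q M0 by simp
    have near: "dist (z (k n) t) (z (k n) q) < 3 * e / 8" if "n \<ge> N2" for n
    proof -
      have "dist (z (k n) t) (z (k n) q) \<le> M * \<bar>t - q\<bar> + M / real (Suc (k n))"
        using lip[of q t "k n"] q t by (simp add: dist_norm)
      then show ?thesis using N2[OF that] Mq by linarith
    qed
    show "\<exists>N. \<forall>m\<ge>N. \<forall>n\<ge>N. dist (z (k m) t) (z (k n) t) < e"
    proof (intro exI[of _ "max N1 N2"] allI impI)
      fix m n assume mn: "max N1 N2 \<le> m" "max N1 N2 \<le> n"
      have "dist (z (k m) t) (z (k n) t) \<le> dist (z (k m) t) (z (k m) q) + dist (z (k m) q) (z (k n) q) + dist (z (k n) t) (z (k n) q)"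
        by (smt (verit) dist_commute dist_triangle)
      with near[of m] near[of n] N1[of m n] mn show "dist (z (k m) t) (z (k n) t) < e" by auto
    qed
  qed
  define u where "u t = lim (\<lambda>n. z (k n) t)" for t
  have u: "(\<lambda>n. z (k n) t) \<longlonglongrightarrow> u t" if "t \<ge> 0" for t
    using conv[OF that] by (simp add: u_def convergent_LIMSEQ_iff)
  have u0: "u 0 = x0" using u[of 0] by (simp add: z0 LIMSEQ_const_iff)
  \<comment> \<open>Near \<open>t\<close> all relevant Euler steps use a value of \<open>g\<close> that is \<open>e\<close>-close to \<open>g (u t)\<close>.\<close>
  have key: "\<exists>d>0. \<forall>a b. 0 \<le> a \<longrightarrow> a \<le> b \<longrightarrow> \<bar>a - t\<bar> < d \<longrightarrow> \<bar>b - t\<bar> < d \<longrightarrow>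
      norm (u b - u a - (b - a) *\<^sub>R g (u t)) \<le> (b - a) * e" if t: "t \<ge> 0" and e: "e > 0" for t e
  proof -
    have "isCont g (u t)" using cont by (simp add: continuous_on_eq_continuous_at)
    then obtain \<eta> where \<eta>: "\<eta> > 0" "\<And>x. norm (x - u t) < \<eta> \<Longrightarrow> norm (g x - g (u t)) < e"
      using e unfolding continuous_at_eps_delta dist_norm by blast
    define d where "d = \<eta> / (4 * (M + 1))"
    have d: "d > 0" using \<eta> M0 by (simp add: d_def)
    have Md: "M * d \<le> \<eta> / 4" using M0 \<eta> by (simp add: d_def field_simps)
    show ?thesis
    proof (intro exI[of _ d] conjI d allI impI)
      fix a b assume ab: "0 \<le> a" "a \<le> b" "\<bar>a - t\<bar> < d" "\<bar>b - t\<bar> < d"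
      have ev: "\<forall>\<^sub>F n in sequentially. norm (z (k n) t - u t) < \<eta> / 4 \<and> 2 * M / real (Suc (k n)) < \<eta> / 4"
        using order_tendstoD(2)[OF klarge[of "2 * M"], of "\<eta> / 4"] tendstoD[OF u[OF t], of "\<eta> / 4"] \<eta>(1)
        by (intro eventually_conj) (auto simp: dist_norm)
      have "\<forall>\<^sub>F n in sequentially. norm (z (k n) b - z (k n) a - (b - a) *\<^sub>R g (u t))
          \<le> (b - a) * e + (e + norm (g (u t))) / real (Suc (k n))"
        using ev
      proof eventually_elim
        case (elim n)
        show ?case
        proof (rule inc)
          fix \<tau> assume \<tau>: "a \<le> \<tau> + 1 / real (Suc (k n))" "\<tau> \<le> b" "0 \<le> \<tau>"
          have "norm (z (k n) \<tau> - z (k n) t) \<le> M * \<bar>\<tau> - t\<bar> + M / real (Suc (k n))"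
            using lip[of t \<tau> "k n"] t \<tau> by simp
          also have "\<bar>\<tau> - t\<bar> \<le> d + 1 / real (Suc (k n))"
            using \<tau> ab zero_le_divide_1_iff[of "real (Suc (k n))"] by linarith
          finally have "norm (z (k n) \<tau> - z (k n) t) \<le> M * (d + 1 / real (Suc (k n))) + M / real (Suc (k n))"
            using M0 by (auto intro: mult_left_mono)
          also have "\<dots> = M * d + 2 * M / real (Suc (k n))" by (simp add: distrib_left)
          finally have "norm (z (k n) \<tau> - z (k n) t) < \<eta> / 2" using Md elim by linarith
          then have "norm (z (k n) \<tau> - u t) < \<eta>"
            using elim norm_triangle_ineq[of "z (k n) \<tau> - z (k n) t" "z (k n) t - u t"] \<eta> by simp
          then show "norm (g (z (k n) \<tau>) - g (u t)) \<le> e" using \<eta>(2) by force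
        qed (use ab e in auto)
      qed
      moreover have "(\<lambda>n. norm (z (k n) b - z (k n) a - (b - a) *\<^sub>R g (u t))) \<longlonglongrightarrow> norm (u b - u a - (b - a) *\<^sub>R g (u t))"
        using u[of a] u[of b] ab by (intro tendsto_intros) auto
      moreover have "(\<lambda>n. (b - a) * e + (e + norm (g (u t))) / real (Suc (k n))) \<longlonglongrightarrow> (b - a) * e + 0"
        by (intro tendsto_intros klarge)
      ultimately show "norm (u b - u a - (b - a) *\<^sub>R g (u t)) \<le> (b - a) * e"
        using tendsto_le[OF trivial_limit_sequentially] by fastforce
    qed
  qed
  have "(u has_vector_derivative g (u t)) (at t within {0..})" if t: "t \<ge> 0" for t
    unfolding has_vector_derivative_def has_derivative_within_alt
  proof (intro conjI allI impI)
    show "bounded_linear (\<lambda>x. x *\<^sub>R g (u t))" by (rule bounded_linear_scaleR_left)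
    fix e :: real assume "e > 0"
    from key[OF t this] obtain d where d: "d > 0"
      "\<And>a b. 0 \<le> a \<Longrightarrow> a \<le> b \<Longrightarrow> \<bar>a - t\<bar> < d \<Longrightarrow> \<bar>b - t\<bar> < d \<Longrightarrow> norm (u b - u a - (b - a) *\<^sub>R g (u t)) \<le> (b - a) * e"
      by blast
    show "\<exists>d>0. \<forall>y\<in>{0..}. norm (y - t) < d \<longrightarrow> norm (u y - u t - (y - t) *\<^sub>R g (u t)) \<le> e * norm (y - t)"
    proof (intro exI[of _ d] conjI ballI impI d(1))
      fix y assume y: "y \<in> {0..}" "norm (y - t) < d"
      show "norm (u y - u t - (y - t) *\<^sub>R g (u t)) \<le> e * norm (y - t)"
      proof (cases "t \<le> y")
        case True
        then show ?thesis using d(2)[of t y] y d(1) t by (simp add: mult.commute)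
      next
        case False
        have "norm (u t - u y - (t - y) *\<^sub>R g (u t)) = norm (u y - u t - (y - t) *\<^sub>R g (u t))"
          by (subst norm_minus_commute) (simp add: algebra_simps)
        then show ?thesis using d(2)[of y t] y d(1) False by (simp add: mult.commute)
      qed
    qed
  qed
  with u0 show ?thesis by blast
qed

text \<open>
  A solution on a bounded half-open interval is Lipschitz, so it has a limit at the right end, and a
  solution starting from that limit continues it. At the junction the integral equation gives
  the derivative.
\<close>

theorem ode_continuation:
  fixes g :: "'a::euclidean_space \<Rightarrow> 'a"
  assumes cont: "continuous_on UNIV g" and bdd: "\<And>x. norm (g x) \<le> M" and T: "T > 0"
    and w: "\<And>t. t \<in> {0..<T} \<Longrightarrow> (w has_vector_derivative g (w t)) (at t within {0..<T})"
  shows "\<exists>u. (\<forall>t\<in>{0..<T}. u t = w t) \<and> (\<forall>t\<ge>0. (u has_vector_derivative g (u t)) (at t within {0..}))"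
proof -
  have M0: "M \<ge> 0" using bdd[of 0] norm_ge_zero order_trans by blast
  have lip: "M-lipschitz_on {0..<T} w"
  proof (rule bounded_derivative_imp_lipschitz)
    show "(w has_derivative (\<lambda>s. s *\<^sub>R g (w t))) (at t within {0..<T})" if "t \<in> {0..<T}" for t
      using w[OF that] by (simp add: has_vector_derivative_def)
    show "onorm (\<lambda>s. s *\<^sub>R g (w t)) \<le> M" for t
    proof (rule onorm_bound[OF M0])
      show "norm (s *\<^sub>R g (w t)) \<le> M * norm s" for s
        using mult_left_mono[OF bdd[of "w t"] norm_ge_zero[of s]] by (simp add: mult.commute)
    qed
  qed (use M0 in auto)
  then have "uniformly_continuous_on {0..<T} w" by (rule lipschitz_on_uniformly_continuous)
  then obtain v where v: "uniformly_continuous_on (closure {0..<T}) v" "\<And>x. x \<in> {0..<T} \<Longrightarrow> w x = v x"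
    using uniformly_continuous_on_extension_on_closure[of "{0..<T}" w] by metis
  have vc: "continuous_on {0..T} v" using v(1) T by (simp add: uniformly_continuous_imp_continuous)
  obtain x where x: "x 0 = v T" "\<And>t. t \<ge> 0 \<Longrightarrow> (x has_vector_derivative g (x t)) (at t within {0..})"
    using peano_existence_bounded[OF cont bdd, of "v T"] by blast
  have xc: "continuous_on {0..} x"
    using x(2) by (auto simp: continuous_on_eq_continuous_within intro: has_vector_derivative_continuous)
  define u where "u t = (if t \<le> T then v t else x (t - T))" for t
  have uc: "continuous_on {0..} u"
  proof -
    have "{0..} = {0..T} \<union> {T..}" using T by auto
    moreover have "continuous_on ({0..T} \<union> {T..}) u" unfolding u_def
      by (intro continuous_on_If closed_atLeastAtMost closed_atLeast vc continuous_on_compose2[OF xc])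
         (auto intro!: continuous_intros simp: x(1))
    ultimately show ?thesis by simp
  qed
  have du: "(u has_vector_derivative g (u t)) (at t)" if t: "t > 0" "t \<noteq> T" for t
  proof (cases "t < T")
    case True
    have "(w has_vector_derivative g (w t)) (at t within {0<..<T})"
      by (rule has_vector_derivative_within_subset[OF w]) (use True t in auto)
    then have "(w has_vector_derivative g (w t)) (at t)"
      using at_within_open[of t "{0<..<T}"] True t by simp
    then have "(u has_vector_derivative g (w t)) (at t)"
      by (rule has_vector_derivative_transform_within_open[where S="{0<..<T}"])
         (use True t v(2) in \<open>auto simp: u_def\<close>)
    then show ?thesis using True t v(2)[of t] by (simp add: u_def)
  next
    case False
    then have tT: "t > T" using t by auto
    have "(x has_vector_derivative g (x (t - T))) (at (t - T) within {0<..})"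
      by (rule has_vector_derivative_within_subset[OF x(2)]) (use tT in auto)
    then have "(x has_vector_derivative g (x (t - T))) (at (t - T))"
      using at_within_open[of "t - T" "{0<..}"] tT by simp
    moreover have "((\<lambda>s. s - T) has_vector_derivative 1) (at t)"
      by (auto intro!: derivative_eq_intros)
    ultimately have "((\<lambda>s. x (s - T)) has_vector_derivative g (x (t - T))) (at t)"
      using vector_diff_chain_at[of "\<lambda>s. s - T" 1 t x "g (x (t - T))"] by (simp add: o_def)
    then have "(u has_vector_derivative g (x (t - T))) (at t)"
      by (rule has_vector_derivative_transform_within_open[where S="{T<..}"]) (use tT in \<open>auto simp: u_def\<close>)
    then show ?thesis using tT by (simp add: u_def)
  qed
  have guc: "continuous_on {0..} (\<lambda>s. g (u s))"
    by (rule continuous_on_compose2[OF cont uc]) auto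
  have int: "u t = u 0 + integral {0..t} (\<lambda>s. g (u s))" if "t \<ge> 0" for t
  proof -
    have "((\<lambda>s. g (u s)) has_integral (u t - u 0)) {0..t}"
      by (rule fundamental_theorem_of_calculus_interior_strong[of "{T}"])
         (use that du in \<open>auto intro: continuous_on_subset[OF uc]\<close>)
    then show ?thesis by (simp add: integral_unique)
  qed
  have "(u has_vector_derivative g (u t)) (at t within {0..})" if t: "t \<ge> 0" for t
  proof -
    have "((\<lambda>s. u 0 + integral {0..s} (\<lambda>s. g (u s))) has_vector_derivative 0 + g (u t)) (at t within {0..t+1})"
      by (intro has_vector_derivative_add has_vector_derivative_const integral_has_vector_derivative
          continuous_on_subset[OF guc]) (use t in auto)
    then have "(u has_vector_derivative 0 + g (u t)) (at t within {0..t+1})"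
      by (rule has_vector_derivative_transform[rotated 2]) (use t in simp, rule int, simp)
    then have "(u has_vector_derivative g (u t)) (at t within {0..t+1})" by simp
    moreover have "at t within {0..t+1} = at t within {0..}"
      by (rule at_within_nhd[of _ "{..<t+1}"]) auto
    ultimately show ?thesis by simp
  qed
  moreover have "u t = w t" if "t \<in> {0..<T}" for t using that v(2) by (auto simp: u_def)
  ultimately show ?thesis by blast
qed

section \<open>Convergence of p-th Calabi flows on weighted graphs\<close>

definition signed_power :: "real \<Rightarrow> real \<Rightarrow> real" where
  "signed_power p x = \<bar>x\<bar> powr (p - 2) * x"

lemma signed_power_minus: "signed_power p (- x) = - signed_power p x"
  by (simp add: signed_power_def)

lemma signed_power_pos: "x \<noteq> 0 \<Longrightarrow> x * signed_power p x > 0"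
  by (simp add: signed_power_def mult.left_commute[of x] zero_less_mult_iff)
     (use linorder_neq_iff in blast)

lemma signed_power_nonneg: "x * signed_power p x \<ge> 0"
  using signed_power_pos[of x p] by (cases "x = 0") (auto intro: less_imp_le)

text \<open>
  Splitting into positive and negative parts exhibits the function as a difference of two powers
  with the positive exponent \<open>p - 1\<close>, which are continuous also at \<open>0\<close>.
\<close>

lemma continuous_on_signed_power:
  assumes "p > 1"
  shows "continuous_on UNIV (signed_power p)"
proof -
  have *: "x powr (p - 2) * x = x powr (p - 1)" if "x > 0" for x :: real
    using powr_add[of x "p - 2" 1] that by simp
  have "signed_power p = (\<lambda>x. max x 0 powr (p - 1) - max (- x) 0 powr (p - 1))"
  proof
    fix x :: real
    show "signed_power p x = max x 0 powr (p - 1) - max (- x) 0 powr (p - 1)"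
      using *[of x] *[of "- x"] by (cases x "0 :: real" rule: linorder_cases) (auto simp: signed_power_def)
  qed
  moreover have "continuous_on UNIV (\<lambda>x::real. max x 0 powr (p - 1) - max (- x) 0 powr (p - 1))"
    using assms by (intro continuous_intros continuous_on_powr') auto
  ultimately show ?thesis by simp
qed

lemma mean_value_half_line:
  fixes f f' :: "real \<Rightarrow> real"
  assumes "0 \<le> a" "a < b" and "\<And>t. t \<ge> 0 \<Longrightarrow> (f has_real_derivative f' t) (at t within {0..})"
  shows "\<exists>t\<in>{a<..<b}. f b - f a = f' t * (b - a)"
  by (rule mvt_simple[OF assms(2)], unfold has_field_derivative_def[symmetric],
      rule has_field_derivative_subset[OF assms(3)]) (use assms(1) in auto)

text \<open>
  The flow abstracted from surfaces: \<open>B u\<close> is a conductance matrix on the complete graph with vertices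
  \<open>'v\<close>, whose edges of positive conductance connect all vertices, and the derivative of \<open>K\<close> at \<open>u\<close> is the
  graph Laplacian of \<open>B u\<close>. The symmetry of \<open>B\<close> makes \<open>K\<close> a gradient field, its positivity makes the
  potential convex, and its connectedness makes the potential strictly convex modulo constants. The
  number \<open>k\<close> is the average of \<open>K u\<close>, which does not depend on \<open>u\<close>.
\<close>

locale curvature_system =
  fixes K :: "real^'v::finite \<Rightarrow> real^'v"
    and B :: "real^'v \<Rightarrow> 'v \<Rightarrow> 'v \<Rightarrow> real"
    and p k :: real
  assumes p: "p > 1"
    and B_sym: "B u i j = B u j i"
    and B_nonneg: "B u i j \<ge> 0"
    and B_cont: "continuous_on UNIV (\<lambda>u. B u i j)"
    and B_conn: "(\<And>i j. B u i j > 0 \<Longrightarrow> y i = (y j :: real)) \<Longrightarrow> y i = y j"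
    and K_deriv: "((\<lambda>u. K u $ i) has_derivative (\<lambda>h. \<Sum>j\<in>UNIV. B u i j * (h $ i - h $ j))) (at u)"
    and K_sum: "(\<Sum>i\<in>UNIV. K u $ i) = real CARD('v) * k"
begin

lemma B_continuous_on [continuous_intros]:
  "continuous_on S f \<Longrightarrow> continuous_on S (\<lambda>x. B (f x) i j)"
  by (rule continuous_on_compose2[OF B_cont]) auto

lemma K_continuous_on [continuous_intros]:
  assumes "continuous_on S f"
  shows "continuous_on S (\<lambda>x. K (f x) $ i)"
proof -
  have "continuous_on UNIV (\<lambda>u. K u $ i)"
    by (intro continuous_at_imp_continuous_on ballI has_derivative_continuous[OF K_deriv])
  then show ?thesis by (rule continuous_on_compose2[OF _ assms]) auto
qed

lemma K_curve_deriv: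
  assumes "(\<gamma> has_vector_derivative \<gamma>') (at t within S)"
  shows "((\<lambda>t. K (\<gamma> t) $ i) has_real_derivative (\<Sum>j\<in>UNIV. B (\<gamma> t) i j * (\<gamma>' $ i - \<gamma>' $ j))) (at t within S)"
proof -
  have "((\<lambda>t. K (\<gamma> t) $ i) has_derivative
      (\<lambda>s. \<Sum>j\<in>UNIV. B (\<gamma> t) i j * ((s *\<^sub>R \<gamma>') $ i - (s *\<^sub>R \<gamma>') $ j))) (at t within S)"
    using has_derivative_compose[OF assms[unfolded has_vector_derivative_def] K_deriv] by simp
  then show ?thesis
    by (rule has_derivative_imp_has_field_derivative) (simp add: sum_distrib_left algebra_simps)
qed

text \<open>
  Summation by parts on the graph. It is the source of every identity below: conservation of the
  sum of \<open>u\<close>, the sign of the dissipation, convexity, and the closedness of the curvature form.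
\<close>

lemma antisymmetric_pairing:
  assumes \<phi>: "\<And>i j. \<phi> i j = - \<phi> j i"
  shows "(\<Sum>i\<in>UNIV. x i * (\<Sum>j\<in>UNIV. B u i j * \<phi> i j)) =
    (1 / 2) * (\<Sum>i\<in>UNIV. \<Sum>j\<in>UNIV. B u i j * ((x i - x j) * \<phi> i j))" (is "?A = _")
proof -
  have 1: "?A = (\<Sum>i\<in>UNIV. \<Sum>j\<in>UNIV. B u i j * (x i * \<phi> i j))"
    by (simp add: sum_distrib_left mult_ac)
  also have "\<dots> = (\<Sum>i\<in>UNIV. \<Sum>j\<in>UNIV. B u j i * (x j * \<phi> j i))"
    by (rule sum.swap)
  also have "\<dots> = (\<Sum>i\<in>UNIV. \<Sum>j\<in>UNIV. - (B u i j * (x j * \<phi> i j)))"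
  proof (intro sum.cong refl)
    fix i j show "B u j i * (x j * \<phi> j i) = - (B u i j * (x j * \<phi> i j))"
      using B_sym[of u i j] \<phi>[of i j] by simp
  qed
  finally have "?A + ?A = (\<Sum>i\<in>UNIV. \<Sum>j\<in>UNIV. B u i j * (x i * \<phi> i j)) + (\<Sum>i\<in>UNIV. \<Sum>j\<in>UNIV. - (B u i j * (x j * \<phi> i j)))"
    using 1 by simp
  also have "\<dots> = (\<Sum>i\<in>UNIV. \<Sum>j\<in>UNIV. B u i j * ((x i - x j) * \<phi> i j))"
    by (simp add: sum.distrib[symmetric] algebra_simps)
  finally show ?thesis by simp
qed

definition field :: "real^'v \<Rightarrow> real^'v" where
  "field u = (\<chi> i. \<Sum>j\<in>UNIV. B u i j * signed_power p (K u $ j - K u $ i))"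

lemma field_continuous: "continuous_on UNIV field"
proof -
  have "continuous_on UNIV (\<lambda>u. signed_power p (K u $ j - K u $ i))" for i j
    by (rule continuous_on_compose2[OF continuous_on_signed_power[OF p]]) (auto intro!: continuous_intros)
  then show ?thesis unfolding field_def
    by (intro continuous_on_vec_lambda continuous_intros)
qed

lemma sum_field: "(\<Sum>i\<in>UNIV. field u $ i) = 0"
proof -
  have "(\<Sum>i\<in>UNIV. 1 * (\<Sum>j\<in>UNIV. B u i j * signed_power p (K u $ j - K u $ i))) =
      (1 / 2) * (\<Sum>i\<in>UNIV. \<Sum>j\<in>UNIV. B u i j * ((1 - 1) * signed_power p (K u $ j - K u $ i)))"
    by (rule antisymmetric_pairing[of _ "\<lambda>_. 1"]) (metis minus_diff_eq signed_power_minus)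
  then show ?thesis by (simp add: field_def)
qed

definition dissipation :: "real^'v \<Rightarrow> real" where
  "dissipation u = (1 / 2) * (\<Sum>i\<in>UNIV. \<Sum>j\<in>UNIV. B u i j *
     ((K u $ j - K u $ i) * signed_power p (K u $ j - K u $ i)))"

lemma curvature_pairing_field:
  "(\<Sum>i\<in>UNIV. (K u $ i - k) * field u $ i) = - dissipation u"
proof -
  have "(\<Sum>i\<in>UNIV. (K u $ i - k) * (\<Sum>j\<in>UNIV. B u i j * signed_power p (K u $ j - K u $ i))) =
      (1 / 2) * (\<Sum>i\<in>UNIV. \<Sum>j\<in>UNIV. B u i j * (((K u $ i - k) - (K u $ j - k)) * signed_power p (K u $ j - K u $ i)))"
    by (rule antisymmetric_pairing) (metis minus_diff_eq signed_power_minus)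
  also have "\<dots> = - dissipation u"
  proof -
    have "B u i j * (((K u $ i - k) - (K u $ j - k)) * x) = - (B u i j * ((K u $ j - K u $ i) * x))" for i j x
      by (simp add: algebra_simps)
    then show ?thesis unfolding dissipation_def by (simp add: sum_negf)
  qed
  finally show ?thesis by (simp add: field_def)
qed

lemma dissipation_nonneg: "dissipation u \<ge> 0"
  unfolding dissipation_def
  by (intro mult_nonneg_nonneg sum_nonneg B_nonneg signed_power_nonneg) auto

lemma dissipation_continuous: "continuous_on UNIV dissipation"
proof -
  have "continuous_on UNIV (\<lambda>u. signed_power p (K u $ j - K u $ i))" for i j
    by (rule continuous_on_compose2[OF continuous_on_signed_power[OF p]]) (auto intro!: continuous_intros)
  then show ?thesis unfolding dissipation_def
    by (intro continuous_intros)
qed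

text \<open>
  A sum of nonnegative edge terms vanishes only if each edge of positive conductance contributes
  nothing, and those edges connect the graph.
\<close>

lemma pos_quadratic_form:
  assumes q: "\<And>x. x \<noteq> 0 \<Longrightarrow> q x > 0" and q0: "\<And>x. q x \<ge> 0"
    and "(\<Sum>i\<in>UNIV. \<Sum>j\<in>UNIV. B u i j * q (y j - y i :: real)) = (0::real)"
  shows "y a = y b"
proof (rule B_conn[of u])
  fix i j assume "B u i j > 0"
  have "(\<Sum>j\<in>UNIV. B u i j * q (y j - y i)) = 0"
    using assms(3) by (subst (asm) sum_nonneg_eq_0_iff) (auto intro!: sum_nonneg mult_nonneg_nonneg B_nonneg q0)
  then have "B u i j * q (y j - y i) = 0"
    by (subst (asm) sum_nonneg_eq_0_iff) (auto intro!: mult_nonneg_nonneg B_nonneg q0)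
  then show "y i = y j" using \<open>B u i j > 0\<close> q[of "y j - y i"] by force
qed

lemma constant_curvature_if:
  assumes "\<And>i j. K u $ i = K u $ j"
  shows "K u $ i = k"
proof -
  have "(\<Sum>j\<in>UNIV. K u $ j) = real CARD('v) * K u $ i"
  proof -
    have "(\<Sum>j\<in>UNIV. K u $ j) = (\<Sum>j\<in>(UNIV :: 'v set). K u $ i)" by (intro sum.cong refl assms)
    then show ?thesis by simp
  qed
  then show ?thesis using K_sum[of u] by simp
qed

lemma dissipation_eq_0D:
  assumes "dissipation u = 0"
  shows "K u $ i = k"
proof (rule constant_curvature_if)
  show "K u $ i = K u $ j" for i j
    by (rule pos_quadratic_form[where q="\<lambda>x. x * signed_power p x" and u=u])
       (use assms in \<open>auto simp: dissipation_def intro: signed_power_pos signed_power_nonneg\<close>)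
qed

text \<open>
  The Ricci potential based at \<open>c\<close>: the line integral of the 1-form with coefficients \<open>K\<^sub>i - k\<close> along the
  segment from \<open>c\<close> to \<open>u\<close>.
\<close>

definition energy :: "real^'v \<Rightarrow> real^'v \<Rightarrow> real" where
  "energy c u = integral {0..1} (\<lambda>s. \<Sum>i\<in>UNIV. (K (c + s *\<^sub>R (u - c)) $ i - k) * (u - c) $ i)"

lemma energy_continuous: "continuous_on UNIV (energy c)"
proof -
  have "continuous_on (UNIV \<times> cbox 0 (1::real))
      (\<lambda>(u, s). \<Sum>i\<in>UNIV. (K (c + s *\<^sub>R (u - c)) $ i - k) * (u - c) $ i)"
    unfolding split_def by (intro continuous_intros)
  from integral_continuous_on_param[OF this] show ?thesis
    by (simp add: energy_def[abs_def])
qed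

text \<open>
  The energy is a potential of \<open>K - k\<close>. Differentiating under the integral gives
  \<open>\<integral> s \<langle>u - c, dK[\<gamma>']\<rangle> + \<langle>K - k, \<gamma>'\<rangle> ds\<close>; since \<open>dK\<close> is a symmetric form, the integrand is the
  \<open>s\<close>-derivative of \<open>s \<langle>K - k, \<gamma>'\<rangle>\<close> along the segment. A statement about curves suffices here, because
  the energy is only differentiated along solutions.
\<close>

lemma energy_deriv:
  assumes \<gamma>: "\<And>t. t \<in> S \<Longrightarrow> (\<gamma> has_vector_derivative \<gamma>' t) (at t within S)"
    and \<gamma>': "continuous_on S \<gamma>'" and S: "convex S" "t \<in> S"
  shows "((\<lambda>t. energy c (\<gamma> t)) has_real_derivative (\<Sum>i\<in>UNIV. (K (\<gamma> t) $ i - k) * \<gamma>' t $ i)) (at t within S)"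
proof -
  have \<gamma>c: "continuous_on S \<gamma>"
    using \<gamma> by (auto simp: continuous_on_eq_continuous_within intro: has_vector_derivative_continuous)
  define y where "y t s = c + s *\<^sub>R (\<gamma> t - c)" for t s
  have yc: "continuous_on (S \<times> {0..1}) (\<lambda>x. y (fst x) (snd x))"
    unfolding y_def by (intro continuous_intros continuous_on_compose2[OF \<gamma>c]) auto
  \<comment> \<open>The \<open>t\<close>-derivative of the integrand.\<close>
  define D where "D t s = (\<Sum>i\<in>UNIV. (\<gamma> t - c) $ i * (s * (\<Sum>j\<in>UNIV. B (y t s) i j * (\<gamma>' t $ i - \<gamma>' t $ j)))
      + (K (y t s) $ i - k) * \<gamma>' t $ i)" for t s
  have comp: "((\<lambda>t. \<gamma> t $ i) has_real_derivative \<gamma>' t $ i) (at t within S)" if "t \<in> S" for t i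
    using bounded_linear.has_vector_derivative[OF bounded_linear_vec_nth \<gamma>[OF that]]
    by (simp add: has_real_derivative_iff_has_vector_derivative)
  have "((\<lambda>t. energy c (\<gamma> t)) has_real_derivative integral {0..1} (D t)) (at t within S)"
    unfolding energy_def cbox_interval[symmetric]
  proof (rule leibniz_rule_field_derivative[where U=S])
    fix t s assume t: "t \<in> S"
    have "((\<lambda>t. y t s) has_vector_derivative s *\<^sub>R \<gamma>' t) (at t within S)"
      unfolding y_def using \<gamma>[OF t] by (auto intro!: derivative_eq_intros)
    moreover have "(\<Sum>j\<in>UNIV. B (y t s) i j * ((s *\<^sub>R \<gamma>' t) $ i - (s *\<^sub>R \<gamma>' t) $ j)) =
        s * (\<Sum>j\<in>UNIV. B (y t s) i j * (\<gamma>' t $ i - \<gamma>' t $ j))" for i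
      by (simp add: sum_distrib_left right_diff_distrib mult_ac)
    ultimately have dK: "((\<lambda>t. K (y t s) $ i) has_real_derivative
        s * (\<Sum>j\<in>UNIV. B (y t s) i j * (\<gamma>' t $ i - \<gamma>' t $ j))) (at t within S)" for i
      using K_curve_deriv[of "\<lambda>t. y t s" "s *\<^sub>R \<gamma>' t" t S i] by simp
    have "((\<lambda>t. (K (y t s) $ i - k) * (\<gamma> t $ i - c $ i)) has_real_derivative
        (\<gamma> t - c) $ i * (s * (\<Sum>j\<in>UNIV. B (y t s) i j * (\<gamma>' t $ i - \<gamma>' t $ j)))
        + (K (y t s) $ i - k) * \<gamma>' t $ i) (at t within S)" for i
      using DERIV_mult[OF DERIV_diff[OF dK[of i] DERIV_const[of k]] DERIV_diff[OF comp[OF t, of i] DERIV_const[of "c $ i"]]]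
      by (simp add: mult.commute)
    then show "((\<lambda>t. \<Sum>i\<in>UNIV. (K (c + s *\<^sub>R (\<gamma> t - c)) $ i - k) * (\<gamma> t - c) $ i) has_real_derivative D t s) (at t within S)"
      unfolding D_def y_def[symmetric] vector_minus_component by (intro DERIV_sum)
  next
    fix t show "(\<lambda>s. \<Sum>i\<in>UNIV. (K (c + s *\<^sub>R (\<gamma> t - c)) $ i - k) * (\<gamma> t - c) $ i) integrable_on cbox 0 1"
      by (intro integrable_continuous continuous_intros)
  next
    have "continuous_on (S \<times> {0..1::real}) (\<lambda>x. \<gamma> (fst x))" "continuous_on (S \<times> {0..1::real}) (\<lambda>x. \<gamma>' (fst x))"
      by (auto intro!: continuous_on_compose2[OF \<gamma>c] continuous_on_compose2[OF \<gamma>'] continuous_intros)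
    then show "continuous_on (S \<times> cbox 0 1) (\<lambda>(t, s). D t s)"
      unfolding D_def split_def by (intro continuous_intros yc[folded cbox_interval]; simp)
  qed (use S in auto)
  moreover have "(D t has_integral (1 * (\<Sum>i\<in>UNIV. (K (y t 1) $ i - k) * \<gamma>' t $ i) - 0 * (\<Sum>i\<in>UNIV. (K (y t 0) $ i - k) * \<gamma>' t $ i))) {0..1}"
  proof (rule fundamental_theorem_of_calculus)
    fix s :: real assume s: "s \<in> {0..1}"
    have "(y t has_vector_derivative \<gamma> t - c) (at s within {0..1})"
      unfolding y_def by (auto intro!: derivative_eq_intros)
    from K_curve_deriv[OF this]
    have "((\<lambda>s. s * (\<Sum>i\<in>UNIV. (K (y t s) $ i - k) * \<gamma>' t $ i)) has_real_derivative
        s * (\<Sum>i\<in>UNIV. (\<Sum>j\<in>UNIV. B (y t s) i j * ((\<gamma> t - c) $ i - (\<gamma> t - c) $ j)) * \<gamma>' t $ i)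
        + (\<Sum>i\<in>UNIV. (K (y t s) $ i - k) * \<gamma>' t $ i)) (at s within {0..1})"
      by (auto intro!: derivative_eq_intros)
    moreover have "(\<Sum>i\<in>UNIV. (\<Sum>j\<in>UNIV. B (y t s) i j * ((\<gamma> t - c) $ i - (\<gamma> t - c) $ j)) * \<gamma>' t $ i)
        = (\<Sum>i\<in>UNIV. (\<gamma> t - c) $ i * (\<Sum>j\<in>UNIV. B (y t s) i j * (\<gamma>' t $ i - \<gamma>' t $ j)))"
      using antisymmetric_pairing[of "\<lambda>i j. (\<gamma> t - c) $ i - (\<gamma> t - c) $ j" "\<lambda>i. \<gamma>' t $ i" "y t s"]
        antisymmetric_pairing[of "\<lambda>i j. \<gamma>' t $ i - \<gamma>' t $ j" "\<lambda>i. (\<gamma> t - c) $ i" "y t s"]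
      by (simp add: mult.commute)
    ultimately show "((\<lambda>s. s * (\<Sum>i\<in>UNIV. (K (y t s) $ i - k) * \<gamma>' t $ i)) has_vector_derivative D t s) (at s within {0..1})"
      unfolding has_real_derivative_iff_has_vector_derivative[symmetric] D_def
      by (simp add: sum.distrib sum_distrib_left[of s, symmetric] mult.left_commute[of _ s])
  qed auto
  ultimately show ?thesis by (simp add: y_def integral_unique)
qed

text \<open>The derivative of the energy along the ray from \<open>c\<close> in direction \<open>x\<close>, at parameter \<open>s\<close>.\<close>

definition slope :: "real^'v \<Rightarrow> real^'v \<Rightarrow> real \<Rightarrow> real" where
  "slope c x s = (\<Sum>i\<in>UNIV. (K (c + s *\<^sub>R x) $ i - k) * x $ i)"

lemma slope_deriv:
  "(slope c x has_real_derivative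
     (1 / 2) * (\<Sum>i\<in>UNIV. \<Sum>j\<in>UNIV. B (c + s *\<^sub>R x) i j * (x $ j - x $ i)\<^sup>2)) (at s within S)"
proof -
  have "((\<lambda>s. c + s *\<^sub>R x) has_vector_derivative x) (at s within S)"
    by (auto intro!: derivative_eq_intros)
  from K_curve_deriv[OF this]
  have "(slope c x has_real_derivative (\<Sum>i\<in>UNIV. x $ i * (\<Sum>j\<in>UNIV. B (c + s *\<^sub>R x) i j * (x $ i - x $ j)))) (at s within S)"
    unfolding slope_def by (auto intro!: derivative_eq_intros simp: mult.commute)
  also have "(\<Sum>i\<in>UNIV. x $ i * (\<Sum>j\<in>UNIV. B (c + s *\<^sub>R x) i j * (x $ i - x $ j))) =
      (1 / 2) * (\<Sum>i\<in>UNIV. \<Sum>j\<in>UNIV. B (c + s *\<^sub>R x) i j * ((x $ i - x $ j) * (x $ i - x $ j)))"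
    by (rule antisymmetric_pairing) auto
  also have "\<dots> = (1 / 2) * (\<Sum>i\<in>UNIV. \<Sum>j\<in>UNIV. B (c + s *\<^sub>R x) i j * (x $ j - x $ i)\<^sup>2)"
    by (simp add: power2_commute power2_eq_square[symmetric])
  finally show ?thesis .
qed

lemma slope_mono: "s \<le> t \<Longrightarrow> slope c x s \<le> slope c x t"
  by (rule DERIV_nonneg_imp_nondecreasing)
     (auto intro!: exI conjI slope_deriv[where S=UNIV] mult_nonneg_nonneg sum_nonneg B_nonneg)

lemma slope_strict_mono:
  assumes "s < t" "x \<noteq> 0" "(\<Sum>i\<in>UNIV. x $ i) = 0"
  shows "slope c x s < slope c x t"
proof (rule DERIV_pos_imp_increasing[OF assms(1)])
  fix a
  let ?D = "(1 / 2) * (\<Sum>i\<in>UNIV. \<Sum>j\<in>UNIV. B (c + a *\<^sub>R x) i j * (x $ j - x $ i)\<^sup>2)"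
  have "?D \<noteq> 0"
  proof
    assume "?D = 0"
    then have const: "x $ i = x $ j" for i j
      by (intro pos_quadratic_form[where q="\<lambda>x. x\<^sup>2" and u="c + a *\<^sub>R x" and y="\<lambda>i. x $ i"]) auto
    have "x $ i = 0" for i
    proof -
      have "(\<Sum>j\<in>UNIV. x $ j) = (\<Sum>j\<in>(UNIV :: 'v set). x $ i)" by (intro sum.cong refl const)
      then show ?thesis using assms(3) by simp
    qed
    then show False using assms(2) by (simp add: vec_eq_iff)
  qed
  moreover have "?D \<ge> 0" by (intro mult_nonneg_nonneg sum_nonneg B_nonneg) auto
  ultimately show "\<exists>y. (slope c x has_real_derivative y) (at a) \<and> 0 < y"
    using slope_deriv[of c x a UNIV] by fastforce
qed

lemma slope_continuous: "continuous_on UNIV (\<lambda>x. slope c x s)"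
  unfolding slope_def by (intro continuous_intros)

lemma slope_at_base:
  assumes "\<And>i. K c $ i = k"
  shows "slope c x 0 = 0"
  using assms by (simp add: slope_def)

lemma energy_ray: "energy c (c + r *\<^sub>R x) = r * integral {0..1} (\<lambda>s. slope c x (s * r))"
  by (simp add: energy_def slope_def integral_mult_right[symmetric] sum_distrib_left mult_ac del: integral_mult_right)

text \<open>
  Convexity in quantitative form. On the ray from the critical point \<open>c\<close> in a unit direction \<open>x\<close>, the
  slope of the energy is nonnegative and increasing, so the energy at distance \<open>r \<ge> e\<close> is at least
  \<open>r / 2\<close> times the slope at parameter \<open>e / 2\<close>; that slope has a positive minimum over the compact
  sphere of directions with coordinate sum \<open>0\<close>. The estimate gives properness of the energy, and it
  shows that small energy forces \<open>u\<close> to be near \<open>c\<close>.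
\<close>

lemma energy_linear_growth:
  assumes c: "\<And>i. K c $ i = k" and e: "e > 0"
  shows "\<exists>m>0. \<forall>u. (\<Sum>i\<in>UNIV. u $ i) = (\<Sum>i\<in>UNIV. c $ i) \<longrightarrow> e \<le> norm (u - c) \<longrightarrow>
    m * norm (u - c) \<le> energy c u"
proof -
  define Sph where "Sph = {x :: real^'v. norm x = 1 \<and> (\<Sum>i\<in>UNIV. x $ i) = 0}"
  have "Sph = sphere 0 1 \<inter> (\<lambda>x. \<Sum>i\<in>UNIV. x $ i) -` {0}" by (auto simp: Sph_def)
  moreover have "compact (sphere (0::real^'v) 1 \<inter> (\<lambda>x. \<Sum>i\<in>UNIV. x $ i) -` {0})"
    by (intro compact_Int_closed compact_sphere closed_vimage continuous_intros closed_singleton)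
  ultimately have cpt: "compact Sph" by simp
  have pos: "slope c x (e / 2) > 0" if "x \<in> Sph" for x
  proof -
    have "x \<noteq> 0" using that by (auto simp: Sph_def)
    then show ?thesis
      using slope_strict_mono[of 0 "e / 2" x c] slope_at_base[OF c, of x] e that by (simp add: Sph_def)
  qed
  obtain m where m: "m > 0" "\<And>x. x \<in> Sph \<Longrightarrow> slope c x (e / 2) \<ge> m"
  proof (cases "Sph = {}")
    case True
    then show ?thesis using that[of 1] by simp
  next
    case False
    from continuous_attains_inf[OF cpt False continuous_on_subset[OF slope_continuous]]
    obtain x where "x \<in> Sph" "\<And>y. y \<in> Sph \<Longrightarrow> slope c x (e / 2) \<le> slope c y (e / 2)" by blast
    then show ?thesis using that pos by blast
  qed
  show ?thesis
 proof (intro exI[of _ "m / 2"] conjI allI impI)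
    fix u assume u: "(\<Sum>i\<in>UNIV. u $ i) = (\<Sum>i\<in>UNIV. c $ i)" "e \<le> norm (u - c)"
    define r where "r = norm (u - c)"
    define x where "x = (u - c) /\<^sub>R r"
    have r: "r > 0" "r \<ge> e" using u e by (auto simp: r_def)
    have ux: "u = c + r *\<^sub>R x" using r by (simp add: x_def)
    have "x \<in> Sph" using r u by (auto simp: Sph_def x_def r_def sum_divide_distrib[symmetric] sum_subtractf divide_inverse sum_distrib_left[symmetric])
    then have mx: "m \<le> slope c x (e / 2)" by (rule m)
    have ic: "(\<lambda>s. slope c x (s * r)) integrable_on {a..b}" for a b
      by (intro integrable_continuous_interval) (auto simp: slope_def intro!: continuous_intros)
    have nn: "slope c x (s * r) \<ge> 0" if "s \<ge> 0" for s
      using slope_mono[of 0 "s * r" c x] slope_at_base[OF c, of x] that r by auto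
    have "m / 2 = integral {1/2..1::real} (\<lambda>s. m)" by simp
    also have "\<dots> \<le> integral {1/2..1} (\<lambda>s. slope c x (s * r))"
    proof (rule integral_le)
      fix s :: real assume s: "s \<in> {1/2..1}"
      have "e / 2 \<le> s * r" using s r e mult_mono[of "1/2" s e r] by auto
      then show "m \<le> slope c x (s * r)" using mx slope_mono[of "e / 2" "s * r" c x] by linarith
    qed (auto intro: ic)
    also have "\<dots> \<le> integral {0..1} (\<lambda>s. slope c x (s * r))"
      by (intro integral_subset_le ic ballI nn) auto
    finally have "r * (m / 2) \<le> r * integral {0..1} (\<lambda>s. slope c x (s * r))"
      using r by (intro mult_left_mono) auto
    also have "\<dots> = energy c u" by (subst ux) (rule energy_ray[symmetric])
    finally show "m / 2 * norm (u - c) \<le> energy c u"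
      unfolding r_def[symmetric] by (simp only: mult.commute)
  qed (use m in auto)
qed

lemma K_eq_k_unique:
  assumes c: "\<And>i. K c $ i = k" and u: "\<And>i. K u $ i = k" "(\<Sum>i\<in>UNIV. u $ i) = (\<Sum>i\<in>UNIV. c $ i)"
  shows "u = c"
proof (rule ccontr)
  assume "u \<noteq> c"
  then have "slope c (u - c) 0 < slope c (u - c) 1"
    using u by (intro slope_strict_mono) (auto simp: sum_subtractf)
  then show False using c u by (simp add: slope_def)
qed

context
  fixes u :: "real \<Rightarrow> real^'v"
  assumes sol: "\<And>t. t \<ge> 0 \<Longrightarrow> (u has_vector_derivative field (u t)) (at t within {0..})"
begin

lemma sol_continuous: "continuous_on {0..} u"
  using sol by (auto simp: continuous_on_eq_continuous_within intro: has_vector_derivative_continuous)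

lemma sol_component_deriv:
  "t \<ge> 0 \<Longrightarrow> ((\<lambda>t. u t $ i) has_real_derivative field (u t) $ i) (at t within {0..})"
  using bounded_linear.has_vector_derivative[OF bounded_linear_vec_nth sol]
  by (simp add: has_real_derivative_iff_has_vector_derivative)

lemma sol_sum: "t \<ge> 0 \<Longrightarrow> (\<Sum>i\<in>UNIV. u t $ i) = (\<Sum>i\<in>UNIV. u 0 $ i)"
proof (cases "t = 0")
  case False
  assume "t \<ge> 0"
  have "((\<lambda>t. \<Sum>i\<in>UNIV. u t $ i) has_real_derivative 0) (at t within {0..})" if "t \<ge> 0" for t
    using DERIV_sum[of UNIV "\<lambda>t i. u t $ i", OF sol_component_deriv[OF that]] by (simp add: sum_field)
  from mean_value_half_line[of 0 t, OF _ _ this] \<open>t \<ge> 0\<close> False show ?thesis by auto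
qed auto

lemma sol_energy_deriv:
  "t \<ge> 0 \<Longrightarrow> ((\<lambda>t. energy c (u t)) has_real_derivative - dissipation (u t)) (at t within {0..})"
  using energy_deriv[of "{0..}" u "\<lambda>t. field (u t)" t c, OF sol
      continuous_on_compose2[OF field_continuous sol_continuous]] curvature_pairing_field[of "u t"]
  by simp

lemma sol_energy_decreasing:
  assumes "0 \<le> s" "s \<le> t"
  shows "energy c (u t) \<le> energy c (u s)"
proof (cases "s = t")
  case False
  with assms obtain x where "energy c (u t) - energy c (u s) = - dissipation (u x) * (t - s)"
    using mean_value_half_line[OF _ _ sol_energy_deriv] by (metis order_le_less)
  moreover have "dissipation (u x) * (t - s) \<ge> 0"
    using dissipation_nonneg[of "u x"] assms by (intro mult_nonneg_nonneg) auto
  ultimately show ?thesis by linarith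
qed simp

text \<open>
  A limit of a solution is a zero of the field, since the increments over unit time intervals tend to
  \<open>0\<close> and are values of the field. Pairing the field with \<open>K - k\<close> shows that the dissipation vanishes.
\<close>

theorem limit_has_constant_curvature:
  assumes "(u \<longlongrightarrow> L) at_top"
  shows "K L $ i = k"
proof (rule dissipation_eq_0D)
  have f0: "field L $ i = 0" for i
  proof -
    have "\<exists>x. x > real n \<and> x < real n + 1 \<and> u (real n + 1) $ i - u (real n) $ i = field (u x) $ i" for n
      using mean_value_half_line[of "real n" "real n + 1", OF _ _ sol_component_deriv] by fastforce
    then obtain x where x: "\<And>n. x n > real n" "\<And>n. u (real n + 1) $ i - u (real n) $ i = field (u (x n)) $ i"
      by metis
    have "filterlim x at_top sequentially"
      by (rule filterlim_at_top_mono[OF filterlim_real_sequentially]) (use x(1) in \<open>auto intro!: always_eventually less_imp_le\<close>)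
    then have ux: "(\<lambda>n. u (x n)) \<longlonglongrightarrow> L" using assms filterlim_compose by blast
    have "isCont field L" using field_continuous by (simp add: continuous_on_eq_continuous_at)
    from isCont_tendsto_compose[OF this ux] have 1: "(\<lambda>n. field (u (x n)) $ i) \<longlonglongrightarrow> field L $ i"
      by (rule tendsto_vec_nth)
    have "(\<lambda>n. u (real n)) \<longlonglongrightarrow> L"
      by (rule filterlim_compose[OF assms filterlim_real_sequentially])
    moreover have "(\<lambda>n. u (real n + 1)) \<longlonglongrightarrow> L"
      using filterlim_compose[OF assms filterlim_tendsto_add_at_top[OF tendsto_const[of 1] filterlim_real_sequentially]]
      by (simp add: add.commute)
    ultimately have "(\<lambda>n. u (real n + 1) $ i - u (real n) $ i) \<longlonglongrightarrow> L $ i - L $ i"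
      by (intro tendsto_intros)
    with 1 show ?thesis unfolding x(2) using LIMSEQ_unique by force
  qed
  have "(\<Sum>i\<in>UNIV. (K L $ i - k) * field L $ i) = 0" by (simp add: f0)
  then show "dissipation L = 0" by (simp add: curvature_pairing_field)
qed

text \<open>
  LaSalle's argument. The sum of the coordinates is conserved and the energy decreases, so by
  properness the solution stays in a compact set. If the energy stayed above \<open>\<epsilon> > 0\<close>, the dissipation
  would be bounded below by a positive constant on the compact set of points that remain, because its
  only zero with the given coordinate sum is \<open>c\<close>, where the energy is \<open>0\<close>; the energy would then become
  negative. So the energy tends to \<open>0\<close>, which forces convergence to \<open>c\<close>.
\<close>

theorem converges_to_constant_curvature:
  assumes c: "\<And>i. K c $ i = k" and sum: "(\<Sum>i\<in>UNIV. u 0 $ i) = (\<Sum>i\<in>UNIV. c $ i)"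
  shows "(u \<longlongrightarrow> c) at_top"
proof -
  define H where "H = {v :: real^'v. (\<Sum>i\<in>UNIV. v $ i) = (\<Sum>i\<in>UNIV. c $ i)}"
  have uH: "u t \<in> H" if "t \<ge> 0" for t using sol_sum[OF that] sum by (simp add: H_def)
  have growth: "\<exists>m>0. \<forall>v\<in>H. e \<le> norm (v - c) \<longrightarrow> m * norm (v - c) \<le> energy c v" if "e > 0" for e
    using energy_linear_growth[OF c that] by (auto simp: H_def)
  have Enn: "energy c v \<ge> 0" if "v \<in> H" for v
  proof (cases "v = c")
    case True
    then show ?thesis by (simp add: energy_def)
  next
    case False
    then have e: "norm (v - c) > 0" by simp
    obtain m where "m > 0" and m: "\<forall>w\<in>H. norm (v - c) \<le> norm (w - c) \<longrightarrow> m * norm (w - c) \<le> energy c w"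
      using growth[OF e] by metis
    have "energy c v \<ge> m * norm (v - c)" using m that by simp
    moreover have "m * norm (v - c) \<ge> 0" using \<open>m > 0\<close> by simp
    ultimately show ?thesis by linarith
  qed
  obtain R where R: "norm (u t - c) \<le> R" if "t \<ge> 0" for t
  proof -
    obtain m where m: "m > 0" "\<And>v. v \<in> H \<Longrightarrow> norm (v - c) \<ge> 1 \<Longrightarrow> energy c v \<ge> m * norm (v - c)"
      using growth[of 1] by (metis zero_less_one)
    have "norm (u t - c) \<le> max 1 (energy c (u 0) / m)" if "t \<ge> 0" for t
    proof (cases "norm (u t - c) \<ge> 1")
      case True
      have "m * norm (u t - c) \<le> energy c (u 0)"
        using m(2)[OF uH[OF that] True] sol_energy_decreasing[of 0 t c] that by simp
      then have "norm (u t - c) \<le> energy c (u 0) / m" using m(1) by (simp add: field_simps)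
      then show ?thesis by simp
    qed simp
    then show ?thesis using that by blast
  qed
  have small: "\<exists>T\<ge>0. energy c (u T) < \<epsilon>" if \<epsilon>: "\<epsilon> > 0" for \<epsilon>
  proof (rule ccontr)
    assume "\<not> ?thesis"
    then have ge: "energy c (u t) \<ge> \<epsilon>" if "t \<ge> 0" for t using that by force
    define C where "C = cball c R \<inter> (H \<inter> energy c -` {\<epsilon>..})"
    have "H = (\<lambda>v. \<Sum>i\<in>UNIV. v $ i) -` {\<Sum>i\<in>UNIV. c $ i}" by (auto simp: H_def)
    moreover have "closed ((\<lambda>v::real^'v. \<Sum>i\<in>UNIV. v $ i) -` {\<Sum>i\<in>UNIV. c $ i})"
      by (intro closed_vimage continuous_intros closed_singleton)
    ultimately have "closed H" by simp
    then have cC: "compact C" unfolding C_def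
      by (intro compact_Int_closed compact_cball closed_Int closed_vimage energy_continuous closed_atLeast)
    have uC: "u t \<in> C" if "t \<ge> 0" for t
      using R[OF that] uH[OF that] ge[OF that] by (simp add: C_def dist_norm norm_minus_commute)
    then have "u 0 \<in> C" by simp
    then have "C \<noteq> {}" by blast
    from continuous_attains_inf[OF cC this continuous_on_subset[OF dissipation_continuous]]
    obtain v where v: "v \<in> C" "\<And>x. x \<in> C \<Longrightarrow> dissipation v \<le> dissipation x" by blast
    have d: "dissipation v > 0"
    proof (rule ccontr)
      assume "\<not> dissipation v > 0"
      then have "dissipation v = 0" using dissipation_nonneg[of v] by simp
      then have "v = c" using K_eq_k_unique[OF c dissipation_eq_0D] v(1) by (auto simp: C_def H_def)
      then show False using v(1) \<epsilon> by (simp add: C_def energy_def)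
    qed
    define t where "t = (energy c (u 0) + 1) / dissipation v"
    have "energy c (u 0) \<ge> 0" using Enn uH by simp
    then have t: "t > 0" using d by (simp add: t_def)
    obtain x where x: "x \<in> {0<..<t}" "energy c (u t) - energy c (u 0) = - dissipation (u x) * (t - 0)"
      using mean_value_half_line[OF order_refl t sol_energy_deriv[of _ c]] by blast
    have "dissipation v * t \<le> dissipation (u x) * t"
      using v(2)[OF uC] x t by (intro mult_right_mono) auto
    moreover have "dissipation v * t = energy c (u 0) + 1" using d by (simp add: t_def)
    ultimately have "energy c (u t) < 0" using x by simp
    moreover have "energy c (u t) \<ge> 0" using t by (intro Enn uH) simp
    ultimately show False by simp
  qed
  show ?thesis
  proof (rule tendstoI)
    fix e :: real assume e: "e > 0"
    obtain m where m: "m > 0" "\<And>v. v \<in> H \<Longrightarrow> norm (v - c) \<ge> e \<Longrightarrow> energy c v \<ge> m * norm (v - c)"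
      using growth[OF e] by metis
    obtain T where T: "T \<ge> 0" "energy c (u T) < m * e" using small[of "m * e"] m e by auto
    show "\<forall>\<^sub>F t in at_top. dist (u t) c < e"
      using eventually_ge_at_top[of T]
    proof eventually_elim
      case (elim t)
      show ?case
      proof (rule ccontr)
        assume "\<not> ?case"
        then have ge: "norm (u t - c) \<ge> e" by (simp add: dist_norm)
        then have "m * e \<le> m * norm (u t - c)" using m by simp
        also have "\<dots> \<le> energy c (u t)" using m(2)[OF uH ge] T elim by simp
        also have "\<dots> \<le> energy c (u T)" using sol_energy_decreasing T elim by simp
        finally show False using T by simp
      qed
    qed
  qed
qed

end

end

section \<open>Triangles of three circles\<close>

text \<open>
  Throughout, \<open>x\<close>, \<open>y\<close>, \<open>z\<close> are the radii of circles about the corners of a triangle, and \<open>a\<close>, \<open>b\<close>, \<open>c\<close> are the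
  cosines of the intersection angles of the pairs \<open>xy\<close>, \<open>xz\<close>, \<open>yz\<close>. Then \<open>side_sq x y a\<close> is a squared side
  length, \<open>dot_sides\<close> is the inner product of the two sides at the corner \<open>x\<close>, \<open>cross_sq\<close> is the squared
  cross product of these sides, which is four times the squared area, and \<open>edge_weight\<close> is the derivative
  of the angle at \<open>x\<close> with respect to \<open>ln y\<close>. In \<open>cross_sq\<close> and in the numerator \<open>edge_num\<close> the terms are
  arranged so that each of them is nonnegative for nonnegative cosines.
\<close>

definition side_sq :: "real \<Rightarrow> real \<Rightarrow> real \<Rightarrow> real" where
  "side_sq x y a = x\<^sup>2 + y\<^sup>2 + 2 * x * y * a"

definition dot_sides :: "real \<Rightarrow> real \<Rightarrow> real \<Rightarrow> real \<Rightarrow> real \<Rightarrow> real \<Rightarrow> real" where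
  "dot_sides x y z a b c = x\<^sup>2 + x * y * a + x * z * b - y * z * c"

definition cross_sq :: "real \<Rightarrow> real \<Rightarrow> real \<Rightarrow> real \<Rightarrow> real \<Rightarrow> real \<Rightarrow> real" where
  "cross_sq x y z a b c = x\<^sup>2 * y\<^sup>2 * (1 - a\<^sup>2) + x\<^sup>2 * z\<^sup>2 * (1 - b\<^sup>2) + y\<^sup>2 * z\<^sup>2 * (1 - c\<^sup>2)
     + 2 * x * y * z * (x * (c + a * b) + y * (b + a * c) + z * (a + b * c))"

definition edge_num :: "real \<Rightarrow> real \<Rightarrow> real \<Rightarrow> real \<Rightarrow> real \<Rightarrow> real \<Rightarrow> real" where
  "edge_num x y z a b c = x\<^sup>2 * y\<^sup>2 * (1 - a\<^sup>2) + x * y * z * (y * (b + a * c) + x * (c + a * b))"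

definition edge_weight :: "real \<Rightarrow> real \<Rightarrow> real \<Rightarrow> real \<Rightarrow> real \<Rightarrow> real \<Rightarrow> real" where
  "edge_weight x y z a b c = edge_num x y z a b c / (sqrt (cross_sq x y z a b c) * side_sq x y a)"

definition corner :: "real \<Rightarrow> real \<Rightarrow> real \<Rightarrow> real \<Rightarrow> real \<Rightarrow> real \<Rightarrow> real" where
  "corner x y z a b c = arccos (dot_sides x y z a b c / sqrt (side_sq x y a * side_sq x z b))"

lemma lagrange_identity:
  "side_sq x y a * side_sq x z b = (dot_sides x y z a b c)\<^sup>2 + cross_sq x y z a b c"
  unfolding side_sq_def dot_sides_def cross_sq_def by (simp add: power2_eq_square algebra_simps)

lemma cross_sq_swap: "cross_sq x z y b a c = cross_sq x y z a b c"
  unfolding cross_sq_def by (simp add: algebra_simps)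

lemma cross_sq_rotate: "cross_sq y z x c a b = cross_sq x y z a b c"
  unfolding cross_sq_def by (simp add: algebra_simps)

lemma edge_weight_sym: "edge_weight y x z a c b = edge_weight x y z a b c"
  unfolding edge_weight_def edge_num_def side_sq_def cross_sq_def by (simp add: algebra_simps)

locale circle_triple =
  fixes x y z a b c :: real
  assumes pos: "x > 0" "y > 0" "z > 0"
    and cos_range: "0 \<le> a" "a \<le> 1" "0 \<le> b" "b \<le> 1" "0 \<le> c" "c \<le> 1"
begin

lemma one_minus_sq: "0 \<le> 1 - a\<^sup>2" "0 \<le> 1 - b\<^sup>2" "0 \<le> 1 - c\<^sup>2"
  using cos_range by (auto simp: power_le_one)

lemma side_sq_pos: "side_sq x y a > 0" "side_sq x z b > 0" "side_sq y z c > 0"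
  unfolding side_sq_def using pos cos_range by (auto intro!: add_pos_nonneg mult_nonneg_nonneg)

text \<open>
  The height of the triangle over the side \<open>xy\<close> cannot degenerate: among the nonnegative terms of
  \<open>cross_sq\<close> keep those with the factor \<open>z\<^sup>2\<close>, without the one that contains \<open>a\<close>. After \<open>x\<close> and \<open>y\<close> are
  replaced by their minimum, the cosines enter only through \<open>(1 - b\<^sup>2) + (1 - c\<^sup>2) + 2bc = 2 - (b - c)\<^sup>2\<close>, which is at
  least \<open>1\<close> because \<open>b\<close> and \<open>c\<close> lie in the unit interval.
\<close>

lemma min_height: "z\<^sup>2 * (min x y)\<^sup>2 \<le> cross_sq x y z a b c"
proof -
  let ?m = "min x y"
  have m: "0 < ?m" using pos by simp
  have "(b - c)\<^sup>2 \<le> 1"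
    using cos_range by (simp add: abs_square_le_1 abs_le_iff)
  then have "?m\<^sup>2 * 1 \<le> ?m\<^sup>2 * ((1 - b\<^sup>2) + (1 - c\<^sup>2) + 2 * (b * c))"
    by (intro mult_left_mono) (auto simp: power2_eq_square algebra_simps)
  also have "\<dots> = ?m\<^sup>2 * (1 - b\<^sup>2) + ?m\<^sup>2 * (1 - c\<^sup>2) + 2 * ((?m * ?m) * (b * c))"
    by (simp add: power2_eq_square algebra_simps)
  also have "\<dots> \<le> x\<^sup>2 * (1 - b\<^sup>2) + y\<^sup>2 * (1 - c\<^sup>2) + 2 * ((x * y) * (b * c))"
    using m one_minus_sq cos_range pos
    by (intro add_mono mult_mono power_mono) (auto intro!: mult_nonneg_nonneg)
  finally have "z\<^sup>2 * ?m\<^sup>2 \<le> z\<^sup>2 * (x\<^sup>2 * (1 - b\<^sup>2) + y\<^sup>2 * (1 - c\<^sup>2) + 2 * ((x * y) * (b * c)))"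
    by (intro mult_left_mono) auto
  also have "\<dots> = cross_sq x y z a b c - (x\<^sup>2 * y\<^sup>2 * (1 - a\<^sup>2) + 2 * x * y * z * (x * (c + a * b) + y * (b + a * c) + z * a))"
    unfolding cross_sq_def by (simp add: power2_eq_square algebra_simps)
  also have "\<dots> \<le> cross_sq x y z a b c"
  proof -
    have "0 \<le> x\<^sup>2 * y\<^sup>2 * (1 - a\<^sup>2)" using one_minus_sq by simp
    moreover have "0 \<le> 2 * x * y * z * (x * (c + a * b) + y * (b + a * c) + z * a)"
      using pos cos_range by (intro mult_nonneg_nonneg add_nonneg_nonneg) auto
    ultimately show ?thesis by linarith
  qed
  finally show ?thesis .
qed

lemma cross_sq_pos: "cross_sq x y z a b c > 0"
  using min_height pos by (smt (verit) min_def mult_pos_pos zero_less_power)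

lemma edge_num_nonneg: "edge_num x y z a b c \<ge> 0"
  unfolding edge_num_def using pos cos_range one_minus_sq
  by (auto intro!: add_nonneg_nonneg mult_nonneg_nonneg)

lemma edge_weight_nonneg: "edge_weight x y z a b c \<ge> 0"
  unfolding edge_weight_def using edge_num_nonneg cross_sq_pos side_sq_pos by auto

text \<open>
  The weight can vanish: if the circles \<open>x\<close> and \<open>y\<close> touch and the third circle is orthogonal to both, the
  point of contact is the radical centre of the three circles, so the radical centre lies on the side \<open>xy\<close>.
  No other configuration is degenerate.
\<close>

lemma edge_weight_eq_0D:
  assumes "edge_weight x y z a b c = 0"
  shows "a = 1" "b = 0" "c = 0"
proof -
  have n: "edge_num x y z a b c = 0"
    using assms cross_sq_pos side_sq_pos unfolding edge_weight_def by auto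
  have 1: "x\<^sup>2 * y\<^sup>2 * (1 - a\<^sup>2) \<ge> 0" "x * y * z * (y * (b + a * c) + x * (c + a * b)) \<ge> 0"
    using pos cos_range one_minus_sq by (auto intro!: add_nonneg_nonneg mult_nonneg_nonneg)
  with n have 2: "x\<^sup>2 * y\<^sup>2 * (1 - a\<^sup>2) = 0" "x * y * z * (y * (b + a * c) + x * (c + a * b)) = 0"
    unfolding edge_num_def by linarith+
  then have "a\<^sup>2 = 1" using pos by auto
  then show "a = 1" using cos_range by (simp add: power2_eq_1_iff)
  have "y * (b + a * c) + x * (c + a * b) = 0" using 2 pos by simp
  moreover have "y * (b + a * c) \<ge> 0" "x * (c + a * b) \<ge> 0"
    using pos cos_range by (auto intro!: add_nonneg_nonneg mult_nonneg_nonneg)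
  ultimately have "y * (b + a * c) = 0" "x * (c + a * b) = 0" by linarith+
  then have "b + a * c = 0" "c + a * b = 0" using pos by auto
  moreover have "a * c \<ge> 0" "a * b \<ge> 0" using cos_range by auto
  ultimately show "b = 0" "c = 0" using cos_range by linarith+
qed

text \<open>
  Scaling all radii leaves the weight unchanged, but the space of radii modulo scaling is not compact, so
  the bound needs an argument. The first summand of the numerator is at most the product of
  \<open>sqrt cross_sq\<close> with \<open>x y\<close>, and the second is controlled by the height estimate.
\<close>

lemma edge_weight_le: "edge_weight x y z a b c \<le> 5"
proof -
  let ?S = "sqrt (cross_sq x y z a b c)" and ?l = "side_sq x y a"
  have S: "?S > 0" using cross_sq_pos by simp
  have A: "x\<^sup>2 * y\<^sup>2 * (1 - a\<^sup>2) \<le> ?S * ?l"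
  proof -
    have "x\<^sup>2 * y\<^sup>2 * (1 - a\<^sup>2) \<le> cross_sq x y z a b c"
    proof -
      have "0 \<le> x\<^sup>2 * z\<^sup>2 * (1 - b\<^sup>2)" "0 \<le> y\<^sup>2 * z\<^sup>2 * (1 - c\<^sup>2)" using one_minus_sq by simp_all
      moreover have "0 \<le> 2 * x * y * z * (x * (c + a * b) + y * (b + a * c) + z * (a + b * c))"
        using pos cos_range by (intro mult_nonneg_nonneg add_nonneg_nonneg) auto
      ultimately show ?thesis unfolding cross_sq_def by linarith
    qed
    then have 1: "sqrt (x\<^sup>2 * y\<^sup>2 * (1 - a\<^sup>2)) \<le> ?S" by (rule real_sqrt_le_mono)
    have "sqrt (x\<^sup>2 * y\<^sup>2 * (1 - a\<^sup>2)) \<le> sqrt ((x * y)\<^sup>2)"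
      using pos by (intro real_sqrt_le_mono) (auto simp: power_mult_distrib mult_left_le)
    also have "\<dots> = x * y" using pos by simp
    also have "\<dots> \<le> ?l"
    proof -
      have "0 < x * y" "0 \<le> 2 * x * y * a" using pos cos_range by simp_all
      with sum_squares_bound[of x y] show ?thesis unfolding side_sq_def by linarith
    qed
    finally have 2: "sqrt (x\<^sup>2 * y\<^sup>2 * (1 - a\<^sup>2)) \<le> ?l" .
    have "x\<^sup>2 * y\<^sup>2 * (1 - a\<^sup>2) = sqrt (x\<^sup>2 * y\<^sup>2 * (1 - a\<^sup>2)) * sqrt (x\<^sup>2 * y\<^sup>2 * (1 - a\<^sup>2))"
      using one_minus_sq by simp
    also have "\<dots> \<le> ?S * ?l" using 1 2 S one_minus_sq by (intro mult_mono) auto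
    finally show ?thesis .
  qed
  have B: "x * y * z * (y * (b + a * c) + x * (c + a * b)) \<le> 4 * (?S * ?l)"
  proof -
    have bc: "b + a * c \<le> 2" "c + a * b \<le> 2"
      using cos_range mult_le_one[of a c] mult_le_one[of a b] by linarith+
    have "x * y * z * (y * (b + a * c) + x * (c + a * b)) \<le> x * y * z * (y * 2 + x * 2)"
      using bc pos by (intro mult_left_mono add_mono) auto
    also have "\<dots> = (z * min x y) * (2 * (max x y * (x + y)))"
      by (simp add: min_def max_def algebra_simps)
    also have "\<dots> \<le> ?S * (4 * ?l)"
    proof (rule mult_mono)
      show "z * min x y \<le> ?S"
        using min_height by (intro real_le_rsqrt) (simp add: power_mult_distrib)
      have "max x y * (x + y) \<le> 2 * (x\<^sup>2 + y\<^sup>2)"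
      proof -
        have "x * y \<le> 2 * x\<^sup>2 + y\<^sup>2" "x * y \<le> x\<^sup>2 + 2 * y\<^sup>2"
          using sum_squares_bound[of x y] zero_le_power2[of x] zero_le_power2[of y] by linarith+
        then show ?thesis by (simp add: max_def power2_eq_square algebra_simps)
      qed
      also have "x\<^sup>2 + y\<^sup>2 \<le> ?l" using pos cos_range unfolding side_sq_def by simp
      finally show "2 * (max x y * (x + y)) \<le> 4 * ?l" by linarith
    qed (use pos S in auto)
    finally show ?thesis by simp
  qed
  have "edge_num x y z a b c \<le> 5 * (?S * ?l)" unfolding edge_num_def using A B by simp
  then show ?thesis unfolding edge_weight_def
    using mult_pos_pos[OF S side_sq_pos(1)] by (simp add: divide_le_eq)
qed

lemma cos_corner_less_1: "\<bar>dot_sides x y z a b c / sqrt (side_sq x y a * side_sq x z b)\<bar> < 1"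
proof -
  have "(dot_sides x y z a b c)\<^sup>2 < side_sq x y a * side_sq x z b"
    using lagrange_identity[of x y a z b c] cross_sq_pos by simp
  then have "\<bar>dot_sides x y z a b c\<bar> < sqrt (side_sq x y a * side_sq x z b)"
    by (metis real_sqrt_abs real_sqrt_less_mono)
  then show ?thesis using side_sq_pos by (simp add: abs_divide)
qed

lemma corner_range: "0 < corner x y z a b c" "corner x y z a b c < pi"
  using arccos_lt_bounded[of "dot_sides x y z a b c / sqrt (side_sq x y a * side_sq x z b)"]
    cos_corner_less_1 unfolding corner_def by linarith+

lemma cos_corner: "cos (corner x y z a b c) = dot_sides x y z a b c / sqrt (side_sq x y a * side_sq x z b)"
  unfolding corner_def using cos_corner_less_1 by (intro cos_arccos_abs) linarith

lemma sin_corner: "sin (corner x y z a b c) = sqrt (cross_sq x y z a b c) / sqrt (side_sq x y a * side_sq x z b)"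
proof -
  let ?q = "side_sq x y a * side_sq x z b"
  have q: "?q > 0" using side_sq_pos by simp
  have "sin (corner x y z a b c) = sqrt (1 - (cos (corner x y z a b c))\<^sup>2)"
    using corner_range by (intro sin_cos_sqrt sin_ge_zero) simp_all
  also have "1 - (cos (corner x y z a b c))\<^sup>2 = cross_sq x y z a b c / ?q"
    unfolding cos_corner power_divide using q lagrange_identity[of x y a z b c] by (simp add: field_simps)
  finally show ?thesis by (simp add: real_sqrt_divide)
qed

end

lemma circle_triple_rotate: "circle_triple x y z a b c \<Longrightarrow> circle_triple y z x c a b"
  unfolding circle_triple_def by auto

context circle_triple
begin

text \<open>
  The addition theorem gives \<open>cos (\<alpha> + \<beta>) = cos (\<pi> - \<gamma>)\<close>, and \<open>sin (\<alpha> + \<beta>)\<close> is positive since the inner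
  products at two corners add up to the squared length of their common side. So \<open>\<alpha> + \<beta> < \<pi>\<close>, where the
  cosine is injective.
\<close>

theorem corner_sum: "corner x y z a b c + corner y z x c a b + corner z x y b c a = pi"
proof -
  interpret r: circle_triple y z x c a b by (rule circle_triple_rotate) unfold_locales
  interpret r2: circle_triple z x y b c a by (rule circle_triple_rotate) unfold_locales
  let ?\<alpha> = "corner x y z a b c" and ?\<beta> = "corner y z x c a b" and ?\<gamma> = "corner z x y b c a"
  define A B C where "A = sqrt (side_sq y z c)" and "B = sqrt (side_sq x z b)" and "C = sqrt (side_sq x y a)"
  have ABC: "A > 0" "B > 0" "C > 0" using side_sq_pos by (auto simp: A_def B_def C_def)
  have sq: "side_sq y z c = A\<^sup>2" "side_sq x z b = B\<^sup>2" "side_sq x y a = C\<^sup>2"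
    using side_sq_pos by (auto simp: A_def B_def C_def)
  have sym: "side_sq y x a = side_sq x y a" "side_sq z x b = side_sq x z b" "side_sq z y c = side_sq y z c"
    by (auto simp: side_sq_def)
  define S where "S = sqrt (cross_sq x y z a b c)"
  have S: "S > 0" "S\<^sup>2 = cross_sq x y z a b c" using cross_sq_pos by (auto simp: S_def)
  have Srot: "cross_sq y z x c a b = cross_sq x y z a b c" "cross_sq z x y b c a = cross_sq x y z a b c"
    using cross_sq_rotate by metis+
  define P Q R where "P = dot_sides x y z a b c" and "Q = dot_sides y z x c a b" and "R = dot_sides z x y b c a"
  have cs: "cos ?\<alpha> = P / (C * B)" "sin ?\<alpha> = S / (C * B)" "cos ?\<beta> = Q / (A * C)" "sin ?\<beta> = S / (A * C)"
    "cos ?\<gamma> = R / (B * A)" "sin ?\<gamma> = S / (B * A)"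
    unfolding cos_corner sin_corner r.cos_corner r.sin_corner r2.cos_corner r2.sin_corner Srot sym
      P_def Q_def R_def S_def A_def B_def C_def by (simp_all add: real_sqrt_mult)
  have PQ: "P + Q = C\<^sup>2"
    unfolding P_def Q_def sq[symmetric] dot_sides_def side_sq_def by (simp add: algebra_simps)
  have PQS: "P * Q - S\<^sup>2 = - R * C\<^sup>2"
    unfolding P_def Q_def R_def S sq[symmetric] dot_sides_def side_sq_def cross_sq_def
    by (simp add: power2_eq_square algebra_simps)
  have "(P * Q - S\<^sup>2) / (A * B * C\<^sup>2) = - cos ?\<gamma>"
    unfolding PQS cs using ABC by (simp add: field_simps)
  moreover have "cos (?\<alpha> + ?\<beta>) = (P * Q - S\<^sup>2) / (A * B * C\<^sup>2)"
    unfolding cos_add cs using ABC by (simp add: field_simps power2_eq_square)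
  ultimately have "cos (?\<alpha> + ?\<beta>) = - cos ?\<gamma>"
    by simp
  then have cos: "cos (?\<alpha> + ?\<beta>) = cos (pi - ?\<gamma>)" by simp
  have "sin (?\<alpha> + ?\<beta>) = S * (P + Q) / (A * B * C\<^sup>2)"
    unfolding sin_add cs using ABC by (simp add: field_simps power2_eq_square)
  then have sin: "sin (?\<alpha> + ?\<beta>) > 0" unfolding PQ using ABC S by simp
  have "?\<alpha> + ?\<beta> < pi"
  proof (rule ccontr)
    assume "\<not> ?thesis"
    then have "sin (?\<alpha> + ?\<beta> - pi) \<ge> 0"
      using corner_range r.corner_range by (intro sin_ge_zero) auto
    then show False using sin by simp
  qed
  then have "?\<alpha> + ?\<beta> = pi - ?\<gamma>"
    using corner_range r.corner_range r2.corner_range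
    by (intro cos_inj_pi[OF _ _ _ _ cos]) linarith+
  then show ?thesis by simp
qed

text \<open>
  The functions \<open>X'\<close>, \<open>Y'\<close>, \<open>Z'\<close> are the derivatives of the logarithms of the radii. In these coordinates
  the derivative of an angle involves only the differences along the two sides that meet in the corner,
  and the coefficient of a side is symmetric in its end points.
\<close>

theorem corner_has_derivative:
  fixes X Y Z :: "'a::real_normed_vector \<Rightarrow> real"
  assumes X: "(X has_derivative (\<lambda>h. x * X' h)) (at u within U)" "X u = x"
    and Y: "(Y has_derivative (\<lambda>h. y * Y' h)) (at u within U)" "Y u = y"
    and Z: "(Z has_derivative (\<lambda>h. z * Z' h)) (at u within U)" "Z u = z"
  shows "((\<lambda>u. corner (X u) (Y u) (Z u) a b c) has_derivative
    (\<lambda>h. edge_weight x y z a b c * (Y' h - X' h) + edge_weight x z y b a c * (Z' h - X' h))) (at u within U)"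
proof -
  define P p q where "P u = dot_sides (X u) (Y u) (Z u) a b c" and "p u = side_sq (X u) (Y u) a"
    and "q u = side_sq (X u) (Z u) b" for u
  define P' where "P' h = x * X' h * (2 * x + y * a + z * b) + y * Y' h * (x * a - z * c) + z * Z' h * (x * b - y * c)" for h
  define p' where "p' h = x * X' h * (2 * x + 2 * y * a) + y * Y' h * (2 * y + 2 * x * a)" for h
  define q' where "q' h = x * X' h * (2 * x + 2 * z * b) + z * Z' h * (2 * z + 2 * x * b)" for h
  note XYZ = X(2) Y(2) Z(2)
  have dP: "(P has_derivative P') (at u within U)"
    unfolding P_def[abs_def] dot_sides_def P'_def[abs_def]
    by (rule derivative_eq_intros X(1) Y(1) Z(1) refl)+ (simp add: XYZ algebra_simps power2_eq_square fun_eq_iff)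
  have dp: "(p has_derivative p') (at u within U)"
    unfolding p_def[abs_def] side_sq_def p'_def[abs_def]
    by (rule derivative_eq_intros X(1) Y(1) Z(1) refl)+ (simp add: XYZ algebra_simps power2_eq_square fun_eq_iff)
  have dq: "(q has_derivative q') (at u within U)"
    unfolding q_def[abs_def] side_sq_def q'_def[abs_def]
    by (rule derivative_eq_intros X(1) Y(1) Z(1) refl)+ (simp add: XYZ algebra_simps power2_eq_square fun_eq_iff)
  have pq: "p u > 0" "q u > 0" "p u = side_sq x y a" "q u = side_sq x z b" "P u = dot_sides x y z a b c"
    using side_sq_pos by (auto simp: p_def q_def P_def XYZ)
  define L where "L = sqrt (p u * q u)"
  have L: "L > 0" "L\<^sup>2 = p u * q u" using pq by (auto simp: L_def)
  have dL: "((\<lambda>u. sqrt (p u * q u)) has_derivative (\<lambda>h. (p u * q' h + p' h * q u) * (inverse L / 2))) (at u within U)"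
    unfolding L_def using pq
    by (intro DERIV_compose_FDERIV[OF DERIV_real_sqrt] has_derivative_mult dp dq) auto
  have dX: "((\<lambda>u. P u / sqrt (p u * q u)) has_derivative
      (\<lambda>h. (P' h * L - P u * ((p u * q' h + p' h * q u) * (inverse L / 2))) / (L * L))) (at u within U)"
    using has_derivative_divide'[OF dP dL] L by (simp add: L_def[symmetric])
  define S where "S = sqrt (cross_sq x y z a b c)"
  have S: "S > 0" "S\<^sup>2 = cross_sq x y z a b c" using cross_sq_pos by (auto simp: S_def)
  have X1: "\<bar>P u / L\<bar> < 1" using cos_corner_less_1 by (simp add: L_def pq)
  have sq1: "sqrt (1 - (P u / L)\<^sup>2) = S / L"
  proof -
    have "S\<^sup>2 = L\<^sup>2 - (P u)\<^sup>2"
      unfolding L S pq using lagrange_identity[of x y a z b c] by simp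
    then have "1 - (P u / L)\<^sup>2 = S\<^sup>2 / L\<^sup>2"
      using L(1) by (simp add: power_divide diff_divide_distrib)
    then show ?thesis using S(1) L(1) by (simp add: real_sqrt_divide)
  qed
  have "((\<lambda>u. arccos (P u / sqrt (p u * q u))) has_derivative
      (\<lambda>h. (P' h * L - P u * ((p u * q' h + p' h * q u) * (inverse L / 2))) / (L * L)
           * inverse (- sqrt (1 - (P u / L)\<^sup>2)))) (at u within U)"
    using X1 unfolding L_def[symmetric]
    by (intro DERIV_compose_FDERIV[OF _ dX[unfolded L_def[symmetric]]], unfold L_def[symmetric])
       (intro DERIV_arccos; linarith)
  moreover have "(P' h * L - P u * ((p u * q' h + p' h * q u) * (inverse L / 2))) / (L * L)
           * inverse (- sqrt (1 - (P u / L)\<^sup>2))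
      = edge_weight x y z a b c * (Y' h - X' h) + edge_weight x z y b a c * (Z' h - X' h)" (is "?l = ?r") for h
  proof -
    have "?l = (P u * (p u * q' h + p' h * q u) / 2 - P' h * L\<^sup>2) / (S * L\<^sup>2)"
      unfolding sq1 using L(1) S(1) by (simp add: field_simps power2_eq_square)
    also have "\<dots> = (P u * (p u * q' h + p' h * q u) / 2 - P' h * (p u * q u)) / (S * (p u * q u))"
      by (simp only: L)
    finally have l: "?l = (P u * (p u * q' h + p' h * q u) / 2 - P' h * (p u * q u)) / (S * (p u * q u))" .
    have "P u * (p u * q' h + p' h * q u) - 2 * (P' h * (p u * q u))
      = 2 * (edge_num x y z a b c * q u * (Y' h - X' h) + edge_num x z y b a c * p u * (Z' h - X' h))"
      unfolding pq P'_def p'_def q'_def edge_num_def side_sq_def dot_sides_def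
      by (simp add: power2_eq_square algebra_simps)
    moreover have "s - 2 * t = 2 * w \<Longrightarrow> s / 2 - t = w" for s t w :: real by simp
    ultimately have num: "P u * (p u * q' h + p' h * q u) / 2 - P' h * (p u * q u)
      = edge_num x y z a b c * q u * (Y' h - X' h) + edge_num x z y b a c * p u * (Z' h - X' h)"
      by blast
    have "?l = (edge_num x y z a b c * q u * (Y' h - X' h) + edge_num x z y b a c * p u * (Z' h - X' h)) / (S * (p u * q u))"
      by (simp only: l num)
    also have "(edge_num x y z a b c * q u * (Y' h - X' h) + edge_num x z y b a c * p u * (Z' h - X' h)) / (S * (p u * q u)) = ?r"
      unfolding edge_weight_def cross_sq_swap[of x z y b a c] S_def[symmetric] pq(3,4)[symmetric]
      using pq(1,2) S(1) by (simp add: field_simps)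
    finally show ?thesis .
  qed
  ultimately show ?thesis unfolding corner_def P_def[symmetric] p_def[symmetric] q_def[symmetric] by simp
qed

end

section \<open>Triangulated closed surfaces: two faces at each edge\<close>

lemma continuous_on_if_const:
  "continuous_on A f \<Longrightarrow> continuous_on A g \<Longrightarrow> continuous_on A (\<lambda>x. if b then f x else g x)"
  by (cases b) simp_all

lemma card_3_distinct:
  assumes "card {i, j, k} = 3"
  shows "i \<noteq> j" "i \<noteq> k" "j \<noteq> k"
  using assms by (auto simp: card_insert_if split: if_splits)

lemma card_uniform_fibres:
  fixes h :: "'p::finite \<Rightarrow> 'b"
  assumes "\<And>a. a \<in> A \<Longrightarrow> card {p. h p = a} = c" and "finite A"
  shows "card {p. h p \<in> A} = c * card A"
proof -
  have "{p. h p \<in> A} = (\<Union>a\<in>A. {p. h p = a})" by auto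
  also have "card \<dots> = (\<Sum>a\<in>A. card {p. h p = a})"
    using assms(2) by (intro card_UN_disjoint) auto
  finally show ?thesis using assms by simp
qed

locale triangulated_surface =
  fixes X :: "'a topology" and E F :: "'v::finite set set"
  assumes surface: "closed_surface X" and triang: "triangulation_of X E F"
begin

lemma two_complex: "two_complex E F"
  using triang by (simp add: triangulation_of_def)

lemma card_edge: "e \<in> E \<Longrightarrow> card e = 2"
  using two_complex by (auto simp: two_complex_def)

lemma card_face: "f \<in> F \<Longrightarrow> card f = 3"
  using two_complex by (auto simp: two_complex_def)

lemma face_edges:
  assumes "{i, j, k} \<in> F"
  shows "{i, j} \<in> E" "{i, k} \<in> E" "{j, k} \<in> E"
proof -
  note d = card_3_distinct[OF card_face[OF assms]]
  have sub: "e \<in> E" if "e \<subseteq> {i, j, k}" "card e = 2" for e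
    using two_complex assms that unfolding two_complex_def by blast
  show "{i, j} \<in> E" "{i, k} \<in> E" "{j, k} \<in> E"
    using d by (auto intro!: sub)
qed

text \<open>
  Charts of the abstract surface are transported to the geometric realization, where the combinatorics
  of faces is visible.
\<close>

lemma chart:
  assumes "x \<in> realization E F"
  obtains W S f g where "openin (top_of_set (realization E F)) W" "x \<in> W" "open (S :: (real^2) set)"
    "homeomorphism W S f g"
proof -
  let ?M = "realization E F"
  have "X homeomorphic_space top_of_set ?M" using triang by (simp add: triangulation_of_def)
  then obtain F' G where FG: "homeomorphic_maps X (top_of_set ?M) F' G"
    unfolding homeomorphic_space_def by blast
  then have GM: "homeomorphic_map (top_of_set ?M) X G" and FM: "homeomorphic_map X (top_of_set ?M) F'"
    using homeomorphic_maps_map by blast+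
  have "G x \<in> topspace X"
    using GM assms homeomorphic_imp_surjective_map by fastforce
  then obtain U S where U: "openin X U" "G x \<in> U" "open (S :: (real^2) set)" "subtopology X U homeomorphic_space top_of_set S"
    using surface unfolding closed_surface_def by blast
  have UX: "U \<subseteq> topspace X" using U openin_subset by blast
  define W where "W = F' ` U"
  have WM: "W \<subseteq> ?M"
    using UX homeomorphic_imp_surjective_map[OF FM] by (auto simp: W_def)
  have W: "openin (top_of_set ?M) W"
    unfolding W_def using homeomorphic_map_openness[OF FM UX] U by simp
  have "F' (G x) = x" using FG assms by (simp add: homeomorphic_maps_def)
  then have xW: "x \<in> W" using U by (force simp: W_def)
  have "homeomorphic_map (subtopology X U) (subtopology (top_of_set ?M) W) F'"
    by (rule homeomorphic_map_subtopologies[OF FM])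
       (use UX WM in \<open>auto simp: W_def Int_absorb1 homeomorphic_imp_surjective_map[OF FM, symmetric]\<close>)
  then have "subtopology X U homeomorphic_space top_of_set W"
    using homeomorphic_map_imp_homeomorphic_space WM by (fastforce simp: subtopology_subtopology Int_absorb1)
  then have "top_of_set W homeomorphic_space top_of_set S"
    using U homeomorphic_space_sym homeomorphic_space_trans by blast
  then obtain f g where "homeomorphic_maps (top_of_set W) (top_of_set S) f g"
    unfolding homeomorphic_space_def by blast
  then have "homeomorphism W S f g"
    unfolding homeomorphic_maps_def homeomorphism_def by (auto simp: image_iff Pi_iff; metis)
  then show ?thesis using that W xW U by blast
qed

text \<open>
  Near an interior point of an edge the realization is a book: the faces at the edge are the pages and the
  edge is the spine.
\<close>

lemma realization_near_edge:
  assumes x: "x \<in> realization E F" and ij: "i \<noteq> j" "x $ i > 0" "x $ j > 0"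
  obtains "{v. x $ v \<noteq> 0} = {i, j}" | k where "{i, j, k} \<in> F" "{v. x $ v \<noteq> 0} = {i, j, k}"
proof -
  let ?s = "{v. x $ v \<noteq> 0}"
  have mem: "i \<in> ?s" "j \<in> ?s" using ij by auto
  have "?s \<in> range (\<lambda>v. {v}) \<union> E \<union> F" using x by (simp add: realization_def)
  then consider v where "?s = {v}" | "?s \<in> E" | "?s \<in> F" by blast
  then show thesis
  proof cases
    case 1
    then show ?thesis using mem ij by auto
  next
    case 2
    then have "card ?s = card {i, j}" using card_edge ij by simp
    then have "?s = {i, j}" using mem card_subset_eq[of ?s "{i, j}"] by auto
    then show ?thesis by (rule that(1))
  next
    case 3
    then have "card (?s - {i, j}) = 1" using card_face mem ij by (simp add: card_Diff_subset)
    then obtain k where "?s - {i, j} = {k}" by (auto simp: card_1_singleton_iff)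
    then have "?s = {i, j, k}" using mem by blast
    then show ?thesis using that(2)[of k] 3 by metis
  qed
qed

definition midpoint_vec :: "'v \<Rightarrow> 'v \<Rightarrow> real^'v" where
  "midpoint_vec i j = (\<chi> v. if v = i \<or> v = j then 1 / 2 else 0)"

lemma midpoint_in_realization:
  assumes "{i, j} \<in> E"
  shows "midpoint_vec i j \<in> realization E F"
proof -
  have "i \<noteq> j" using card_edge[OF assms] by auto
  have "(\<Sum>v\<in>UNIV. midpoint_vec i j $ v) = (\<Sum>v\<in>{i, j}. 1 / 2)"
    unfolding midpoint_vec_def by (intro sum.mono_neutral_cong_right) auto
  moreover have "{v. midpoint_vec i j $ v \<noteq> 0} = {i, j}" by (auto simp: midpoint_vec_def)
  ultimately show ?thesis using assms \<open>i \<noteq> j\<close> unfolding realization_def by (auto simp: midpoint_vec_def)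
qed

lemma realization_near_edge_coords:
  assumes x: "x \<in> realization E F" and ij: "i \<noteq> j" "x $ i > 0" "x $ j > 0"
  defines "s \<equiv> (\<Sum>v\<in>UNIV - {i, j}. x $ v)"
  shows "x $ j = 1 - x $ i - s" "s \<ge> 0"
    "\<exists>k. (s = 0 \<or> {i, j, k} \<in> F) \<and> (\<forall>v. v \<noteq> i \<longrightarrow> v \<noteq> j \<longrightarrow> x $ v = (if v = k then s else 0))"
proof -
  have nn: "x $ v \<ge> 0" for v using x by (simp add: realization_def)
  have "1 = (\<Sum>v\<in>UNIV. x $ v)" using x by (simp add: realization_def)
  also have "\<dots> = s + (\<Sum>v\<in>{i, j}. x $ v)" unfolding s_def by (rule sum.subset_diff) auto
  finally show "x $ j = 1 - x $ i - s" using ij by simp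
  show s0: "s \<ge> 0" unfolding s_def by (intro sum_nonneg nn)
  show "\<exists>k. (s = 0 \<or> {i, j, k} \<in> F) \<and> (\<forall>v. v \<noteq> i \<longrightarrow> v \<noteq> j \<longrightarrow> x $ v = (if v = k then s else 0))"
    using x ij
  proof (rule realization_near_edge)
    assume "{v. x $ v \<noteq> 0} = {i, j}"
    then have z: "x $ v = 0" if "v \<noteq> i" "v \<noteq> j" for v using that by blast
    then have "s = 0" unfolding s_def by (intro sum.neutral) auto
    then show ?thesis using z by auto
  next
    fix k assume k: "{i, j, k} \<in> F" "{v. x $ v \<noteq> 0} = {i, j, k}"
    have d: "k \<noteq> i" "k \<noteq> j" using card_3_distinct[OF card_face[OF k(1)]] by auto
    have z: "x $ v = 0" if "v \<noteq> i" "v \<noteq> j" "v \<noteq> k" for v using that k(2) by blast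
    have "s = (\<Sum>v\<in>{k}. x $ v)"
      unfolding s_def by (rule sum.mono_neutral_right) (use d z in auto)
    then show ?thesis using z k by (intro exI[of _ k]) auto
  qed
qed

text \<open>
  With at most one face at the edge \<open>{i, j}\<close>, the realization near the midpoint of the edge embeds into a
  closed half-plane, by the coordinate at \<open>i\<close> and the sum of the coordinates other than those at \<open>i\<close> and
  \<open>j\<close>. By invariance of domain a chart around the midpoint would have open image in the plane, but the
  midpoint is mapped to the boundary of the half-plane.
\<close>

lemma at_least_two_faces:
  assumes e: "{i, j} \<in> E"
  shows "card {k. {i, j, k} \<in> F} \<ge> 2"
proof (rule ccontr)
  assume "\<not> ?thesis"
  then have "card {k. {i, j, k} \<in> F} \<le> 1" by simp
  then have uniq: "k = l" if "{i, j, k} \<in> F" "{i, j, l} \<in> F" for k l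
    using that card_le_Suc0_iff_eq[of "{k. {i, j, k} \<in> F}"] by simp
  have ij: "i \<noteq> j" using card_edge[OF e] by auto
  let ?M = "realization E F" and ?x = "midpoint_vec i j"
  obtain W S f g where W: "openin (top_of_set ?M) W" "?x \<in> W" "open (S :: (real^2) set)" "homeomorphism W S f g"
    using chart[OF midpoint_in_realization[OF e]] by blast
  define Y where "Y = W \<inter> {x. x $ i > 0 \<and> x $ j > 0}"
  have WM: "W \<subseteq> ?M" using W(1) openin_imp_subset by blast
  have "open {x :: real^'v. x $ i > 0 \<and> x $ j > 0}"
    by (intro open_Collect_conj open_Collect_less continuous_intros)
  then have Yo: "openin (top_of_set W) Y" unfolding Y_def by (simp add: openin_open_Int)
  have xY: "?x \<in> Y" using W by (simp add: Y_def midpoint_vec_def)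
  have "openin (top_of_set S) (f ` Y)"
    using homeomorphism_imp_open_map[OF W(4) Yo] .
  then have fY: "open (f ` Y)" using W(3) openin_open_trans by blast
  define \<pi> :: "real^'v \<Rightarrow> real^2" where
    "\<pi> x = (\<chi> n. if n = 1 then x $ i else (\<Sum>v\<in>UNIV - {i, j}. x $ v))" for x
  have \<pi>1: "\<pi> x $ 1 = x $ i" and \<pi>2: "\<pi> x $ 2 = (\<Sum>v\<in>UNIV - {i, j}. x $ v)" for x
    by (simp_all add: \<pi>_def)
  have \<pi>c: "continuous_on UNIV \<pi>"
  proof -
    have "continuous_on UNIV (\<lambda>x :: real^'v. if n = 1 then x $ i else (\<Sum>v\<in>UNIV - {i, j}. x $ v))" for n :: 2
      by (intro continuous_on_if_const continuous_intros)
    then show ?thesis unfolding \<pi>_def[abs_def] by (rule continuous_on_vec_lambda)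
  qed
  have Yc: "z \<in> ?M" "z $ i > 0" "z $ j > 0" if "z \<in> Y" for z
    using that WM by (auto simp: Y_def)
  have \<pi>inj: "inj_on \<pi> Y"
  proof (rule inj_onI)
    fix x y assume xy: "x \<in> Y" "y \<in> Y" "\<pi> x = \<pi> y"
    define s where "s = \<pi> x $ 2"
    have s: "(\<Sum>v\<in>UNIV - {i, j}. x $ v) = s" "(\<Sum>v\<in>UNIV - {i, j}. y $ v) = s" "x $ i = y $ i"
      using xy(3) \<pi>1 \<pi>2 by (metis s_def)+
    note cx = realization_near_edge_coords[OF Yc(1)[OF xy(1)] ij Yc(2,3)[OF xy(1)], unfolded s(1)]
    note cy = realization_near_edge_coords[OF Yc(1)[OF xy(2)] ij Yc(2,3)[OF xy(2)], unfolded s(2)]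
    obtain k where k: "s = 0 \<or> {i, j, k} \<in> F" "\<And>v. v \<noteq> i \<Longrightarrow> v \<noteq> j \<Longrightarrow> x $ v = (if v = k then s else 0)"
      using cx(3) by blast
    obtain l where l: "s = 0 \<or> {i, j, l} \<in> F" "\<And>v. v \<noteq> i \<Longrightarrow> v \<noteq> j \<Longrightarrow> y $ v = (if v = l then s else 0)"
      using cy(3) by blast
    have "x $ v = y $ v" for v
    proof (cases "v = i \<or> v = j")
      case True
      then show ?thesis using s(3) cx(1) cy(1) by auto
    next
      case False
      then show ?thesis using k l uniq[of k l] by (cases "s = 0") auto
    qed
    then show "x = y" by (simp add: vec_eq_iff)
  qed
  have gf: "g (f z) = z" if "z \<in> Y" for z
    using W(4) that by (simp add: homeomorphism_def Y_def)
  have "open ((\<pi> \<circ> g) ` (f ` Y))"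
  proof (rule invariance_of_domain[OF _ fY])
    have "continuous_on (f ` Y) g"
      by (rule continuous_on_subset[OF homeomorphism_cont2[OF W(4)]])
         (use homeomorphism_image1[OF W(4)] in \<open>auto simp: Y_def\<close>)
    then show "continuous_on (f ` Y) (\<pi> \<circ> g)"
      by (intro continuous_on_compose continuous_on_subset[OF \<pi>c]) auto
    show "inj_on (\<pi> \<circ> g) (f ` Y)"
      using \<pi>inj gf by (auto simp: inj_on_def)
  qed
  also have "(\<pi> \<circ> g) ` (f ` Y) = \<pi> ` Y" using gf by (force simp: image_image)
  finally have "open (\<pi> ` Y)" .
  then have "open ((\<lambda>t. \<pi> ?x - t *\<^sub>R axis 2 1) -` (\<pi> ` Y))"
    by (intro open_vimage continuous_intros)
  moreover have "0 \<in> (\<lambda>t. \<pi> ?x - t *\<^sub>R axis 2 1) -` (\<pi> ` Y)" using xY by simp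
  ultimately obtain \<epsilon> where \<epsilon>: "\<epsilon> > 0" "ball 0 \<epsilon> \<subseteq> (\<lambda>t. \<pi> ?x - t *\<^sub>R axis 2 1) -` (\<pi> ` Y)"
    using open_contains_ball by metis
  have "\<epsilon> / 2 \<in> ball 0 \<epsilon>" using \<epsilon>(1) by simp
  then obtain z where z: "z \<in> Y" "\<pi> ?x - (\<epsilon> / 2) *\<^sub>R axis 2 1 = \<pi> z" using \<epsilon>(2) by blast
  have "\<pi> ?x $ 2 = 0" unfolding \<pi>2 by (intro sum.neutral) (auto simp: midpoint_vec_def)
  then have "\<pi> z $ 2 = - (\<epsilon> / 2)" using arg_cong[OF z(2), of "\<lambda>p. p $ 2"] by simp
  moreover have "\<pi> z $ 2 \<ge> 0"
    unfolding \<pi>2 using realization_near_edge_coords(2)[OF Yc(1)[OF z(1)] ij Yc(2,3)[OF z(1)]] .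
  ultimately show False using \<epsilon> by simp
qed

text \<open>
  With three faces at an edge, two of them form a disc around the midpoint of the edge. Invariance of
  domain makes this disc open in the surface, although the third face contains points arbitrarily
  close to the midpoint.
\<close>

lemma at_most_two_faces:
  assumes e: "{i, j} \<in> E"
  shows "card {k. {i, j, k} \<in> F} \<le> 2"
proof (rule ccontr)
  assume "\<not> ?thesis"
  then have "3 \<le> card {k. {i, j, k} \<in> F}" by simp
  then obtain T where T: "T \<subseteq> {k. {i, j, k} \<in> F}" "card T = 3"
    by (rule obtain_subset_with_card_n)
  then obtain k1 k2 k3 where "T = {k1, k2, k3}" "k1 \<noteq> k2" "k2 \<noteq> k3" "k1 \<noteq> k3"
    by (auto simp: card_3_iff)
  with T have kF: "{i, j, k1} \<in> F" "{i, j, k2} \<in> F" "{i, j, k3} \<in> F" and kd: "k1 \<noteq> k2" "k2 \<noteq> k3" "k1 \<noteq> k3"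
    by auto
  have d: "i \<noteq> j" "k1 \<noteq> i" "k1 \<noteq> j" "k2 \<noteq> i" "k2 \<noteq> j" "k3 \<noteq> i" "k3 \<noteq> j"
    using card_3_distinct[OF card_face[OF kF(1)]] card_3_distinct[OF card_face[OF kF(2)]]
      card_3_distinct[OF card_face[OF kF(3)]] by auto
  let ?M = "realization E F" and ?x = "midpoint_vec i j"
  obtain W S f g where W: "openin (top_of_set ?M) W" "?x \<in> W" "open (S :: (real^2) set)" "homeomorphism W S f g"
    using chart[OF midpoint_in_realization[OF e]] by blast
  have WM: "W \<subseteq> ?M" using W(1) openin_imp_subset by blast
  \<comment> \<open>The plane is folded along its first axis onto the faces at \<open>k1\<close> and \<open>k2\<close>.\<close>
  define \<psi> :: "real^2 \<Rightarrow> real^'v" where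
    "\<psi> p = (\<chi> v. if v = i then 1 / 2 + p $ 1 - \<bar>p $ 2\<bar> / 2 else if v = j then 1 / 2 - p $ 1 - \<bar>p $ 2\<bar> / 2
       else if v = k1 then max (p $ 2) 0 else if v = k2 then max (- p $ 2) 0 else 0)" for p
  have \<psi>: "\<psi> p $ i = 1 / 2 + p $ 1 - \<bar>p $ 2\<bar> / 2" "\<psi> p $ j = 1 / 2 - p $ 1 - \<bar>p $ 2\<bar> / 2"
    "\<psi> p $ k1 = max (p $ 2) 0" "\<psi> p $ k2 = max (- p $ 2) 0" "\<psi> p $ k3 = 0" for p
    using d kd by (simp_all add: \<psi>_def)
  have \<psi>z: "\<psi> p $ v = 0" if "v \<notin> {i, j, k1, k2}" for p v using that by (simp add: \<psi>_def)
  have \<psi>c: "continuous_on A \<psi>" for A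
  proof -
    have "continuous_on A (\<lambda>p :: real^2. if v = i then 1 / 2 + p $ 1 - \<bar>p $ 2\<bar> / 2 else if v = j then 1 / 2 - p $ 1 - \<bar>p $ 2\<bar> / 2
       else if v = k1 then max (p $ 2) 0 else if v = k2 then max (- p $ 2) 0 else 0)" for v
      by (intro continuous_on_if_const continuous_intros) auto
    then show ?thesis unfolding \<psi>_def[abs_def] by (rule continuous_on_vec_lambda)
  qed
  define Q where "Q = {p. \<psi> p $ i > 0 \<and> \<psi> p $ j > 0}"
  have Qo: "open Q" unfolding Q_def
    by (intro open_Collect_conj open_Collect_less continuous_intros \<psi>c)
  have QM: "\<psi> p \<in> ?M" if "p \<in> Q" for p
  proof -
    have pos: "\<psi> p $ i > 0" "\<psi> p $ j > 0" using that by (auto simp: Q_def)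
    have "\<psi> p $ v \<ge> 0" for v
      using pos by (auto simp: \<psi>_def)
    moreover have "(\<Sum>v\<in>UNIV. \<psi> p $ v) = 1"
    proof -
      have "(\<Sum>v\<in>UNIV. \<psi> p $ v) = (\<Sum>v\<in>{i, j, k1, k2}. \<psi> p $ v)"
        by (rule sum.mono_neutral_right) (use \<psi>z in auto)
      also have "\<dots> = 1" using d kd by (simp add: \<psi> max_def abs_if)
      finally show ?thesis .
    qed
    moreover have "{v. \<psi> p $ v \<noteq> 0} \<in> E \<union> F"
    proof -
      consider "p $ 2 = 0" | "p $ 2 > 0" | "p $ 2 < 0" by linarith
      then show ?thesis
      proof cases
        case 1
        then have "\<psi> p $ v \<noteq> 0 \<longleftrightarrow> v \<in> {i, j}" for v
          using pos \<psi>[of p] \<psi>z[of v p] by (cases "v \<in> {i, j, k1, k2}") (use d in auto)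
        then have "{v. \<psi> p $ v \<noteq> 0} = {i, j}" by blast
        then show ?thesis using e by simp
      next
        case 2
        then have "\<psi> p $ v \<noteq> 0 \<longleftrightarrow> v \<in> {i, j, k1}" for v
          using pos \<psi>[of p] \<psi>z[of v p] by (cases "v \<in> {i, j, k1, k2}") (use d kd in auto)
        then have "{v. \<psi> p $ v \<noteq> 0} = {i, j, k1}" by blast
        then show ?thesis using kF by simp
      next
        case 3
        then have "\<psi> p $ v \<noteq> 0 \<longleftrightarrow> v \<in> {i, j, k2}" for v
          using pos \<psi>[of p] \<psi>z[of v p] by (cases "v \<in> {i, j, k1, k2}") (use d kd in auto)
        then have "{v. \<psi> p $ v \<noteq> 0} = {i, j, k2}" by blast
        then show ?thesis using kF by simp
      qed
    qed
    ultimately show ?thesis unfolding realization_def by blast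
  qed
  define U where "U = Q \<inter> \<psi> -` W"
  have "openin (top_of_set Q) U" unfolding U_def
    by (rule continuous_openin_preimage[OF \<psi>c _ W(1)]) (use QM in auto)
  then have Uo: "open U" using Qo openin_open_trans by blast
  have \<psi>U: "\<psi> ` U \<subseteq> W" by (auto simp: U_def)
  have \<psi>inj: "inj_on \<psi> U"
  proof (rule inj_onI)
    fix p q assume "\<psi> p = \<psi> q"
    then have "\<psi> p $ i = \<psi> q $ i" "\<psi> p $ j = \<psi> q $ j" "\<psi> p $ k1 = \<psi> q $ k1" "\<psi> p $ k2 = \<psi> q $ k2" by simp_all
    then have "p $ 2 = q $ 2" "p $ 1 = q $ 1" unfolding \<psi> by (auto simp: max_def abs_if split: if_splits)
    then show "p = q" by (simp add: vec_eq_iff forall_2)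
  qed
  have "open ((f \<circ> \<psi>) ` U)"
  proof (rule invariance_of_domain[OF _ Uo])
    show "continuous_on U (f \<circ> \<psi>)"
      by (intro continuous_on_compose \<psi>c continuous_on_subset[OF homeomorphism_cont1[OF W(4)] \<psi>U])
    have "inj_on f W" using W(4) by (metis homeomorphism_def inj_on_inverseI)
    then show "inj_on (f \<circ> \<psi>) U" using \<psi>inj \<psi>U by (intro comp_inj_on) (auto intro: inj_on_subset)
  qed
  moreover have "(f \<circ> \<psi>) ` U \<subseteq> S" using \<psi>U homeomorphism_image1[OF W(4)] by auto
  ultimately have "openin (top_of_set S) ((f \<circ> \<psi>) ` U)" using open_openin_trans W(3) by blast
  then have "openin (top_of_set W) (g ` ((f \<circ> \<psi>) ` U))"
    by (rule homeomorphism_imp_open_map[OF homeomorphism_symD[OF W(4)]])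
  also have "g ` ((f \<circ> \<psi>) ` U) = \<psi> ` U"
    using W(4) \<psi>U unfolding homeomorphism_def by (force simp: image_image)
  finally have "openin (top_of_set ?M) (\<psi> ` U)" using W(1) openin_trans by blast
  then obtain T where T: "open T" "\<psi> ` U = ?M \<inter> T" by (auto simp: openin_open)
  have "\<psi> 0 = ?x" using d kd by (auto simp: \<psi>_def midpoint_vec_def vec_eq_iff)
  moreover have "0 \<in> Q" by (simp add: Q_def \<psi>)
  ultimately have "0 \<in> U" using W(2) by (simp add: U_def)
  then have "\<psi> 0 \<in> ?M \<inter> T" unfolding T(2)[symmetric] by (rule imageI)
  then have xT: "?x \<in> T" using \<open>\<psi> 0 = ?x\<close> by simp
  \<comment> \<open>A path into the third face, starting at the midpoint.\<close>
  define \<zeta> :: "real \<Rightarrow> real^'v" where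
    "\<zeta> t = (\<chi> v. if v = i \<or> v = j then 1 / 2 - t / 2 else if v = k3 then t else 0)" for t
  have \<zeta>c: "continuous_on UNIV \<zeta>"
  proof -
    have "continuous_on UNIV (\<lambda>t::real. if v = i \<or> v = j then 1 / 2 - t / 2 else if v = k3 then t else 0)" for v
      by (intro continuous_on_if_const continuous_intros) auto
    then show ?thesis unfolding \<zeta>_def[abs_def] by (rule continuous_on_vec_lambda)
  qed
  have "open (\<zeta> -` T)" by (intro open_vimage T(1) \<zeta>c)
  moreover have "\<zeta> 0 = ?x" by (auto simp: \<zeta>_def midpoint_vec_def vec_eq_iff)
  then have "0 \<in> \<zeta> -` T" using xT by simp
  ultimately obtain \<epsilon> where \<epsilon>: "\<epsilon> > 0" "ball 0 \<epsilon> \<subseteq> \<zeta> -` T" using open_contains_ball by metis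
  define t where "t = min (\<epsilon> / 2) (1 / 2)"
  have t: "t > 0" "t \<le> 1 / 2" "t < \<epsilon>" using \<epsilon> by (auto simp: t_def min_def)
  then have "t \<in> ball 0 \<epsilon>" by simp
  then have "\<zeta> t \<in> T" using \<epsilon>(2) by blast
  moreover have "\<zeta> t \<in> ?M"
  proof -
    have "(\<Sum>v\<in>UNIV. \<zeta> t $ v) = (\<Sum>v\<in>{i, j, k3}. \<zeta> t $ v)"
      by (rule sum.mono_neutral_right) (auto simp: \<zeta>_def)
    also have "\<dots> = 1" using d by (simp add: \<zeta>_def)
    finally have "(\<Sum>v\<in>UNIV. \<zeta> t $ v) = 1" .
    moreover have "{v. \<zeta> t $ v \<noteq> 0} = {i, j, k3}" using t d by (auto simp: \<zeta>_def)
    ultimately show ?thesis unfolding realization_def using kF(3) t by (auto simp: \<zeta>_def)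
  qed
  ultimately have "\<zeta> t \<in> \<psi> ` U" unfolding T(2) by simp
  then obtain p where "\<zeta> t = \<psi> p" by blast
  then have "\<zeta> t $ k3 = 0" by (simp add: \<psi>)
  then show False using t d by (simp add: \<zeta>_def)
qed

theorem two_faces_at_edge:
  assumes "{i, j} \<in> E"
  shows "card {k. {i, j, k} \<in> F} = 2"
  using at_least_two_faces[OF assms] at_most_two_faces[OF assms] by simp

lemma card_ordered_faces:
  "card {(i, j, k). {i, j, k} \<in> F} = 6 * card F"
proof -
  have "card {p. (case p of (i, j, k) \<Rightarrow> {i, j, k}) \<in> F} = 6 * card F"
  proof (rule card_uniform_fibres[OF _ finite])
    fix f assume "f \<in> F"
    then obtain a b c where f: "f = {a, b, c}" "a \<noteq> b" "a \<noteq> c" "b \<noteq> c"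
      using card_face[of f] by (auto simp: card_3_iff)
    have "(i, j, k) \<in> {(a, b, c), (a, c, b), (b, a, c), (b, c, a), (c, a, b), (c, b, a)}"
      if ijk: "{i, j, k} = f" for i j k
    proof -
      have "i \<noteq> j" "i \<noteq> k" "j \<noteq> k"
        using card_3_distinct[of i j k] card_face[OF \<open>f \<in> F\<close>] ijk by simp_all
      moreover have "i \<in> {a, b, c}" "j \<in> {a, b, c}" "k \<in> {a, b, c}"
        unfolding f(1)[symmetric] ijk[symmetric] by simp_all
      ultimately show ?thesis by auto
    qed
    then have "{p. (case p of (i, j, k) \<Rightarrow> {i, j, k}) = f}
        = {(a, b, c), (a, c, b), (b, a, c), (b, c, a), (c, a, b), (c, b, a)}"
      by (intro equalityI subsetI) (auto simp: f(1) insert_commute split: prod.splits)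
    then show "card {p. (case p of (i, j, k) \<Rightarrow> {i, j, k}) = f} = 6" using f by simp
  qed
  then show ?thesis by (simp add: split_def)
qed

lemma card_ordered_edges: "card {(i, j). {i, j} \<in> E} = 2 * card E"
proof -
  have "card {p. (case p of (i, j) \<Rightarrow> {i, j}) \<in> E} = 2 * card E"
  proof (rule card_uniform_fibres[OF _ finite])
    fix e assume "e \<in> E"
    then obtain a b where e: "e = {a, b}" "a \<noteq> b"
      using card_edge[of e] by (auto simp: card_2_iff)
    then have "{p. (case p of (i, j) \<Rightarrow> {i, j}) = e} = {(a, b), (b, a)}"
      by (auto simp: doubleton_eq_iff)
    then show "card {p. (case p of (i, j) \<Rightarrow> {i, j}) = e} = 2" using e by simp
  qed
  then show ?thesis by (simp add: split_def)
qed

lemma three_faces_two_edges: "3 * card F = 2 * card E"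
proof -
  let ?A = "SIGMA e:{(i, j). {i, j} \<in> E}. {k. {fst e, snd e, k} \<in> F}"
  have img: "{(i, j, k). {i, j, k} \<in> F} = (\<lambda>((i, j), k). (i, j, k)) ` ?A"
    using face_edges(1) by (force simp: image_iff)
  have "inj_on (\<lambda>((i, j), k). (i, j, k)) ?A" by (auto simp: inj_on_def)
  then have "6 * card F = card ?A"
    unfolding card_ordered_faces[symmetric] img by (rule card_image)
  also have "\<dots> = (\<Sum>e\<in>{(i, j). {i, j} \<in> E}. card {k. {fst e, snd e, k} \<in> F})"
    by (rule card_SigmaI) auto
  also have "\<dots> = (\<Sum>e\<in>{(i, j). {i, j} \<in> E}. 2)"
    using two_faces_at_edge by (intro sum.cong) auto
  also have "\<dots> = 4 * card E" by (simp add: card_ordered_edges)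
  finally show ?thesis by simp
qed

text \<open>
  The total weight that a point of the realization puts on the vertices where \<open>y\<close> takes a given value is
  continuous, and it is \<open>0\<close> or \<open>1\<close> since \<open>y\<close> is constant on each simplex. On a connected realization it is
  constant.
\<close>

lemma edges_connect_vertices:
  assumes conn: "connected_space X" and y: "\<And>i j. {i, j} \<in> E \<Longrightarrow> y i = y j"
  shows "y a = y b"
proof -
  let ?M = "realization E F"
  have "connected_space (top_of_set ?M)"
    using conn triang homeomorphic_connected_space by (auto simp: triangulation_of_def)
  then have cM: "connected ?M" 
    using connectedin_def[of euclidean ?M] by simp
  define h where "h x = (\<Sum>v | y v = y a. x $ v)" for x :: "real^'v"
  have hc: "continuous_on ?M h" unfolding h_def by (intro continuous_intros)
  have h01: "h x \<in> {0, 1}" if x: "x \<in> ?M" for x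
  proof -
    let ?s = "{v. x $ v \<noteq> 0}"
    have "?s \<in> range (\<lambda>v. {v}) \<union> E \<union> F" and s1: "(\<Sum>v\<in>UNIV. x $ v) = 1" using x by (auto simp: realization_def)
    then have yeq: "y v = y w" if "v \<in> ?s" "w \<in> ?s" for v w
    proof -
      have "{v, w} \<in> E" if "v \<noteq> w"
      proof -
        have c2: "card {v, w} = 2" and sub: "{v, w} \<subseteq> ?s" using that \<open>v \<in> ?s\<close> \<open>w \<in> ?s\<close> by auto
        from \<open>?s \<in> range (\<lambda>v. {v}) \<union> E \<union> F\<close> consider u where "?s = {u}" | "?s \<in> E" | "?s \<in> F" by blast
        then show ?thesis
        proof cases
          case 1
          then show ?thesis using sub that by auto
        next
          case 2
          then show ?thesis using card_edge[OF 2] c2 card_subset_eq[OF _ sub] by simp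
        next
          case 3
          then show ?thesis using two_complex c2 sub unfolding two_complex_def by blast
        qed
      qed
      then show ?thesis using y by (cases "v = w") auto
    qed
    show ?thesis
    proof (cases "\<exists>v\<in>?s. y v = y a")
      case True
      then have "\<forall>v\<in>?s. y v = y a" using yeq by metis
      then have "h x = (\<Sum>v\<in>UNIV. x $ v)" unfolding h_def by (intro sum.mono_neutral_left) auto
      then show ?thesis using s1 by simp
    next
      case False
      then have "h x = 0" unfolding h_def by (intro sum.neutral) auto
      then show ?thesis by simp
    qed
  qed
  have ax: "axis v 1 \<in> ?M" for v
  proof -
    have "{w. axis v (1::real) $ w \<noteq> 0} = {v}" by (auto simp: axis_def)
    moreover have "(\<Sum>w\<in>UNIV. axis v (1::real) $ w) = 1" by (simp add: axis_def)
    ultimately show ?thesis unfolding realization_def by (auto simp: axis_def)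
  qed
  have "connected (h ` ?M)" using connected_continuous_image[OF hc cM] .
  moreover have "h ` ?M \<subseteq> {0, 1}" using h01 by (rule image_subsetI)
  then have "finite (h ` ?M)" by (rule finite_subset) simp
  ultimately have "h ` ?M = {} \<or> (\<exists>c. h ` ?M = {c})" by (simp add: connected_finite_iff_sing)
  then obtain c where "h ` ?M = {c}" using ax[of a] by (metis empty_iff imageI)
  then have "h (axis a 1) = h (axis b 1)"
    using imageI[OF ax[of a], of h] imageI[OF ax[of b], of h] by simp
  moreover have "h (axis a 1) = 1" "h (axis b 1) = (if y b = y a then 1 else 0)"
    by (auto simp: h_def axis_def sum.delta if_distrib cong: if_cong)
  ultimately show ?thesis by (simp split: if_splits)
qed

end

section \<open>Curvature in logarithmic coordinates\<close>

definition exp_vec :: "real^'v \<Rightarrow> real^'v" where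
  "exp_vec u = (\<chi> i. exp (u $ i))"

definition ln_vec :: "real^'v \<Rightarrow> real^'v" where
  "ln_vec r = (\<chi> i. ln (r $ i))"

lemma exp_vec_nth [simp]: "exp_vec u $ i = exp (u $ i)"
  by (simp add: exp_vec_def)

lemma ln_vec_nth [simp]: "ln_vec r $ i = ln (r $ i)"
  by (simp add: ln_vec_def)

lemma circle_packing_exp_vec [simp]: "circle_packing_metric (exp_vec u)"
  by (simp add: circle_packing_metric_def)

lemma exp_ln_vec: "circle_packing_metric r \<Longrightarrow> exp_vec (ln_vec r) = r"
  by (simp add: circle_packing_metric_def vec_eq_iff)

lemma ln_exp_vec: "ln_vec (exp_vec u) = u"
  by (simp add: vec_eq_iff)

lemma tendsto_exp_vec: "(u \<longlongrightarrow> l) G \<Longrightarrow> ((\<lambda>t. exp_vec (u t)) \<longlongrightarrow> exp_vec l) G"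
  by (rule vec_tendstoI) (simp add: tendsto_exp tendsto_vec_nth)

lemma tendsto_ln_vec:
  "(r \<longlongrightarrow> l) G \<Longrightarrow> circle_packing_metric l \<Longrightarrow> ((\<lambda>t. ln_vec (r t)) \<longlongrightarrow> ln_vec l) G"
  by (rule vec_tendstoI) (auto intro!: tendsto_ln tendsto_vec_nth simp: circle_packing_metric_def less_imp_neq[symmetric])

lemma has_vector_derivative_vec_iff:
  fixes f :: "real \<Rightarrow> real^'n"
  shows "(f has_vector_derivative f') (at t within S) \<longleftrightarrow>
    (\<forall>i. ((\<lambda>t. f t $ i) has_real_derivative f' $ i) (at t within S))"
  unfolding has_vector_derivative_def has_real_derivative_iff_has_vector_derivative
  by (subst has_derivative_componentwise_within) (auto simp: Basis_vec_def inner_axis)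

lemma continuous_on_edge_weight:
  fixes X Y Z :: "'a::topological_space \<Rightarrow> real"
  assumes X: "continuous_on S X" and Y: "continuous_on S Y" and Z: "continuous_on S Z"
    and t: "\<And>u. u \<in> S \<Longrightarrow> circle_triple (X u) (Y u) (Z u) a b c"
  shows "continuous_on S (\<lambda>u. edge_weight (X u) (Y u) (Z u) a b c)"
  unfolding edge_weight_def
proof (rule continuous_on_divide)
  show "continuous_on S (\<lambda>u. edge_num (X u) (Y u) (Z u) a b c)"
    unfolding edge_num_def by (intro continuous_intros X Y Z)
  show "continuous_on S (\<lambda>u. sqrt (cross_sq (X u) (Y u) (Z u) a b c) * side_sq (X u) (Y u) a)"
    unfolding cross_sq_def side_sq_def by (intro continuous_intros X Y Z)
  show "\<forall>u\<in>S. sqrt (cross_sq (X u) (Y u) (Z u) a b c) * side_sq (X u) (Y u) a \<noteq> 0"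
    using circle_triple.cross_sq_pos[OF t] circle_triple.side_sq_pos(1)[OF t]
    by (metis less_irrefl mult_eq_0_iff real_sqrt_eq_zero_cancel_iff)
qed

locale weighted_triangulation = triangulated_surface X E F
  for X :: "'a topology" and E F :: "'v::finite set set" +
  fixes \<Phi> :: "'v set \<Rightarrow> real"
  assumes \<Phi>: "\<And>e. e \<in> E \<Longrightarrow> 0 \<le> \<Phi> e \<and> \<Phi> e \<le> pi / 2"
    and X_connected: "connected_space X"
begin

definition angle_weight :: "real^'v \<Rightarrow> 'v \<Rightarrow> 'v \<Rightarrow> 'v \<Rightarrow> real" where
  "angle_weight r i j k =
     edge_weight (r $ i) (r $ j) (r $ k) (cos (\<Phi> {i, j})) (cos (\<Phi> {i, k})) (cos (\<Phi> {j, k}))"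

definition conductance :: "real^'v \<Rightarrow> 'v \<Rightarrow> 'v \<Rightarrow> real" where
  "conductance r i j = (\<Sum>k | {i, j, k} \<in> F. angle_weight r i j k)"

lemma triple:
  assumes "{i, j, k} \<in> F" "circle_packing_metric r"
  shows "circle_triple (r $ i) (r $ j) (r $ k) (cos (\<Phi> {i, j})) (cos (\<Phi> {i, k})) (cos (\<Phi> {j, k}))"
proof -
  have "0 \<le> cos (\<Phi> e)" if "e \<in> E" for e
    using \<Phi>[OF that] by (intro cos_ge_zero) auto
  then show ?thesis
    using assms(2) face_edges[OF assms(1)] by (simp add: circle_triple_def circle_packing_metric_def)
qed

lemma angle_eq_corner:
  assumes "circle_triple (r $ i) (r $ j) (r $ k) (cos (\<Phi> {i, j})) (cos (\<Phi> {i, k})) (cos (\<Phi> {j, k}))"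
  shows "angle \<Phi> r i j k = corner (r $ i) (r $ j) (r $ k) (cos (\<Phi> {i, j})) (cos (\<Phi> {i, k})) (cos (\<Phi> {j, k}))"
proof -
  interpret circle_triple "r $ i" "r $ j" "r $ k" "cos (\<Phi> {i, j})" "cos (\<Phi> {i, k})" "cos (\<Phi> {j, k})" by fact
  let ?p = "side_sq (r $ i) (r $ j) (cos (\<Phi> {i, j}))" and ?q = "side_sq (r $ i) (r $ k) (cos (\<Phi> {i, k}))"
    and ?s = "side_sq (r $ j) (r $ k) (cos (\<Phi> {j, k}))"
  let ?P = "dot_sides (r $ i) (r $ j) (r $ k) (cos (\<Phi> {i, j})) (cos (\<Phi> {i, k})) (cos (\<Phi> {j, k}))"
  have l: "edge_length \<Phi> r i j = sqrt ?p" "edge_length \<Phi> r i k = sqrt ?q" "edge_length \<Phi> r j k = sqrt ?s"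
    by (simp_all add: edge_length_def side_sq_def)
  have "?p + ?q - ?s = 2 * ?P" by (simp add: side_sq_def dot_sides_def algebra_simps)
  then have "(?p + ?q - ?s) / (2 * sqrt ?p * sqrt ?q) = ?P / sqrt (?p * ?q)"
    by (simp add: real_sqrt_mult)
  then show ?thesis
    unfolding angle_def inner_angle_def corner_def l using side_sq_pos by simp
qed

lemma angle_swap: "angle \<Phi> r i k j = angle \<Phi> r i j k"
  by (simp add: angle_def inner_angle_def edge_length_def insert_commute algebra_simps)

text \<open>
  Each face at \<open>i\<close> corresponds to two ordered pairs of further vertices, which accounts for the factor
  \<open>1 / 2\<close>. Sums over ordered pairs can be rearranged by plain permutations of indices.
\<close>

lemma curvature_ordered_faces:
  "curvature F \<Phi> r $ i = 2 * pi - (\<Sum>(j, k) | {i, j, k} \<in> F. angle \<Phi> r i j k) / 2"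
proof -
  let ?P = "{(j, k). {i, j, k} \<in> F}" and ?g = "\<lambda>(j, k). {i, j, k}"
  have "(\<Sum>(j, k)\<in>?P. angle \<Phi> r i j k) =
      (\<Sum>f | f \<in> F \<and> i \<in> f. \<Sum>(j, k)\<in>{p \<in> ?P. ?g p = f}. angle \<Phi> r i j k)"
    by (rule sum.group[symmetric]) auto
  also have "\<dots> = (\<Sum>f | f \<in> F \<and> i \<in> f. 2 * face_angle \<Phi> r f i)"
  proof (intro sum.cong refl)
    fix f assume "f \<in> {f. f \<in> F \<and> i \<in> f}"
    then have f: "f \<in> F" "i \<in> f" by auto
    then have "card (f - {i}) = 2" using card_face by simp
    then obtain a b where ab: "f - {i} = {a, b}" "a \<noteq> b" by (auto simp: card_2_iff)
    then have fab: "f = {i, a, b}" using f by blast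
    have "{p \<in> ?P. ?g p = f} = {(a, b), (b, a)}"
    proof (intro equalityI subsetI)
      fix p assume "p \<in> {p \<in> ?P. ?g p = f}"
      then obtain j k where p: "p = (j, k)" "{i, j, k} = f" by auto
      have "i \<noteq> j" "i \<noteq> k" using card_3_distinct[of i j k] card_face[OF f(1)] p by auto
      then have "{j, k} = {a, b}" using ab(1) p(2) by blast
      then show "p \<in> {(a, b), (b, a)}" using p(1) by (auto simp: doubleton_eq_iff)
    qed (use f fab in \<open>auto simp: insert_commute\<close>)
    then have "(\<Sum>(j, k)\<in>{p \<in> ?P. ?g p = f}. angle \<Phi> r i j k) = angle \<Phi> r i a b + angle \<Phi> r i b a"
      using ab(2) by simp
    also have "\<dots> = 2 * face_angle \<Phi> r f i"
      unfolding fab using face_angle_eq[of i a b \<Phi> r] card_face[OF f(1)] fab angle_swap[of r i b a] by simp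
    finally show "(\<Sum>(j, k)\<in>{p \<in> ?P. ?g p = f}. angle \<Phi> r i j k) = 2 * face_angle \<Phi> r f i" .
  qed
  finally show ?thesis by (simp add: curvature_def sum_distrib_left[symmetric])
qed

lemma angle_exp_has_derivative:
  assumes "{i, j, k} \<in> F"
  shows "((\<lambda>u. angle \<Phi> (exp_vec u) i j k) has_derivative
    (\<lambda>h. angle_weight (exp_vec u) i j k * (h $ j - h $ i) + angle_weight (exp_vec u) i k j * (h $ k - h $ i))) (at u)"
proof -
  interpret circle_triple "exp_vec u $ i" "exp_vec u $ j" "exp_vec u $ k" "cos (\<Phi> {i, j})" "cos (\<Phi> {i, k})" "cos (\<Phi> {j, k})"
    by (rule triple[OF assms]) simp
  have d: "((\<lambda>u. exp_vec u $ v) has_derivative (\<lambda>h. exp_vec u $ v * h $ v)) (at u)" for v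
    using DERIV_compose_FDERIV[where f=exp and g="\<lambda>u. u $ v",
        OF DERIV_exp bounded_linear_imp_has_derivative[OF bounded_linear_vec_nth]]
    by (simp add: mult.commute)
  show ?thesis
    using corner_has_derivative[OF d refl d refl d refl] assms
    unfolding angle_weight_def
    by (simp add: angle_eq_corner[OF triple[OF assms circle_packing_exp_vec]] insert_commute[of k j] del: exp_vec_nth)
qed

lemma curvature_has_derivative:
  "((\<lambda>u. curvature F \<Phi> (exp_vec u) $ i) has_derivative
    (\<lambda>h. \<Sum>j\<in>UNIV. conductance (exp_vec u) i j * (h $ i - h $ j))) (at u)"
proof -
  let ?P = "{(j, k). {i, j, k} \<in> F}" and ?w = "angle_weight (exp_vec u)"
  have "((\<lambda>u. \<Sum>(j, k)\<in>?P. angle \<Phi> (exp_vec u) i j k) has_derivative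
      (\<lambda>h. \<Sum>(j, k)\<in>?P. ?w i j k * (h $ j - h $ i) + ?w i k j * (h $ k - h $ i))) (at u)"
    by (rule has_derivative_eq_rhs[OF has_derivative_sum[where I = ?P]])
       (use angle_exp_has_derivative in \<open>auto simp: split_def\<close>)
  from has_derivative_diff[OF has_derivative_const bounded_linear.has_derivative[OF bounded_linear_divide[of 2] this]]
  have 1: "((\<lambda>u. curvature F \<Phi> (exp_vec u) $ i) has_derivative
      (\<lambda>h. 0 - (\<Sum>(j, k)\<in>?P. ?w i j k * (h $ j - h $ i) + ?w i k j * (h $ k - h $ i)) / 2)) (at u)"
    unfolding curvature_ordered_faces .
  have 2: "0 - (\<Sum>(j, k)\<in>?P. ?w i j k * (h $ j - h $ i) + ?w i k j * (h $ k - h $ i)) / 2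
      = (\<Sum>j\<in>UNIV. conductance (exp_vec u) i j * (h $ i - h $ j))" for h
  proof -
    have "(\<Sum>(j, k)\<in>?P. ?w i k j * (h $ k - h $ i)) = (\<Sum>(j, k)\<in>?P. ?w i j k * (h $ j - h $ i))"
      by (rule sum.reindex_bij_witness[where i=prod.swap and j=prod.swap]) (auto simp: insert_commute)
    then have "(\<Sum>(j, k)\<in>?P. ?w i j k * (h $ j - h $ i) + ?w i k j * (h $ k - h $ i))
        = 2 * (\<Sum>(j, k)\<in>?P. ?w i j k * (h $ j - h $ i))"
      by (simp add: sum.distrib split_def)
    also have "(\<Sum>(j, k)\<in>?P. ?w i j k * (h $ j - h $ i)) = - (\<Sum>j\<in>UNIV. conductance (exp_vec u) i j * (h $ i - h $ j))"
    proof -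
      have "?P = (SIGMA j:UNIV. {k. {i, j, k} \<in> F})" by auto
      then have "(\<Sum>(j, k)\<in>?P. ?w i j k * (h $ j - h $ i))
          = (\<Sum>j\<in>UNIV. \<Sum>k | {i, j, k} \<in> F. ?w i j k * (h $ j - h $ i))"
        by (simp add: sum.Sigma)
      also have "\<dots> = (\<Sum>j\<in>UNIV. - (conductance (exp_vec u) i j * (h $ i - h $ j)))"
        by (simp add: conductance_def sum_distrib_right[symmetric] flip: mult_minus_right)
      finally show ?thesis by (simp only: sum_negf)
    qed
    finally show ?thesis by simp
  qed
  show ?thesis using 1 unfolding 2 .
qed

lemma angle_weight_sym: "angle_weight r j i k = angle_weight r i j k"
  unfolding angle_weight_def by (subst edge_weight_sym[symmetric]) (simp add: insert_commute)

lemma conductance_sym: "conductance r j i = conductance r i j"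
  unfolding conductance_def using angle_weight_sym by (simp add: insert_commute)

lemma angle_weight_nonneg:
  "{i, j, k} \<in> F \<Longrightarrow> circle_packing_metric r \<Longrightarrow> 0 \<le> angle_weight r i j k"
  unfolding angle_weight_def by (rule circle_triple.edge_weight_nonneg[OF triple])

lemma conductance_nonneg: "circle_packing_metric r \<Longrightarrow> 0 \<le> conductance r i j"
  unfolding conductance_def by (intro sum_nonneg) (auto intro: angle_weight_nonneg)

lemma conductance_le:
  assumes "circle_packing_metric r"
  shows "conductance r i j \<le> real CARD('v) * 5"
proof -
  have "conductance r i j \<le> real (card {k. {i, j, k} \<in> F}) * 5"
    unfolding conductance_def angle_weight_def
    by (intro sum_bounded_above) (auto intro: circle_triple.edge_weight_le[OF triple] assms)
  also have "\<dots> \<le> real CARD('v) * 5"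
    by (intro mult_right_mono) (auto intro: card_mono)
  finally show ?thesis .
qed

lemma conductance_eq_0:
  assumes "{i, j} \<notin> E"
  shows "conductance r i j = 0"
proof -
  have "{k. {i, j, k} \<in> F} = {}" using face_edges(1) assms by auto
  then show ?thesis by (simp add: conductance_def)
qed

lemma conductance_pos:
  assumes "{i, j, k} \<in> F" "angle_weight r i j k \<noteq> 0" "circle_packing_metric r"
  shows "conductance r i j > 0"
proof -
  have "0 < angle_weight r i j k" using angle_weight_nonneg[OF assms(1,3)] assms(2) by simp
  also have "\<dots> \<le> conductance r i j"
    unfolding conductance_def using assms by (intro member_le_sum) (auto intro: angle_weight_nonneg)
  finally show ?thesis .
qed

text \<open>
  An edge may have conductance \<open>0\<close>, but only if in each of its faces the other two edges have \<open>\<Phi> = \<pi> / 2\<close>.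
  Those two edges then have positive conductance and join its end points through the third vertex.
\<close>

lemma conductance_connected:
  assumes r: "circle_packing_metric r" and y: "\<And>i j. conductance r i j > 0 \<Longrightarrow> y i = y j"
  shows "y a = y b"
proof (rule edges_connect_vertices[OF X_connected])
  fix i j assume e: "{i, j} \<in> E"
  then obtain k where k: "{i, j, k} \<in> F"
    using two_faces_at_edge[OF e] by (metis (no_types, lifting) card.empty empty_Collect_eq zero_neq_numeral)
  show "y i = y j"
  proof (cases "angle_weight r i j k = 0")
    case False
    then show ?thesis using conductance_pos[OF k _ r] y by blast
  next
    case True
    then have c: "cos (\<Phi> {i, j}) = 1" "cos (\<Phi> {i, k}) = 0" "cos (\<Phi> {j, k}) = 0"
      using circle_triple.edge_weight_eq_0D[OF triple[OF k r]] by (auto simp: angle_weight_def)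
    have k': "{i, k, j} \<in> F" "{j, k, i} \<in> F" using k by (auto simp: insert_commute)
    have "angle_weight r i k j \<noteq> 0" "angle_weight r j k i \<noteq> 0"
      using circle_triple.edge_weight_eq_0D(1)[OF triple[OF k'(1) r]]
        circle_triple.edge_weight_eq_0D(1)[OF triple[OF k'(2) r]] c by (auto simp: angle_weight_def)
    then have "y i = y k" "y j = y k"
      using conductance_pos[OF k'(1) _ r] conductance_pos[OF k'(2) _ r] y by blast+
    then show ?thesis by simp
  qed
qed

lemma conductance_continuous: "continuous_on UNIV (\<lambda>u. conductance (exp_vec u) i j)"
  unfolding conductance_def
proof (intro continuous_on_sum)
  fix k assume "k \<in> {k. {i, j, k} \<in> F}"
  then have k: "{i, j, k} \<in> F" by simp
  have "continuous_on UNIV (\<lambda>u :: real^'v. exp_vec u $ v)" for v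
    unfolding exp_vec_nth by (intro continuous_intros)
  then show "continuous_on UNIV (\<lambda>u. angle_weight (exp_vec u) i j k)"
    unfolding angle_weight_def
    by (intro continuous_on_edge_weight triple[OF k circle_packing_exp_vec])
qed

text \<open>
  The combinatorial Gauss-Bonnet formula: the angles of each face add up to \<open>\<pi>\<close>, and \<open>3 |F| = 2 |E|\<close>.
\<close>

lemma sum_curvature:
  assumes r: "circle_packing_metric r"
  shows "(\<Sum>i\<in>UNIV. curvature F \<Phi> r $ i) = 2 * pi * real_of_int (euler_characteristic E F)"
proof -
  let ?T = "{(i, j, k). {i, j, k} \<in> F}"
  have T: "?T = (SIGMA i:UNIV. {(j, k). {i, j, k} \<in> F})" by auto
  have "(\<Sum>i\<in>UNIV. \<Sum>(j, k) | {i, j, k} \<in> F. angle \<Phi> r i j k) = (\<Sum>(i, j, k)\<in>?T. angle \<Phi> r i j k)"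
    unfolding T by (subst sum.Sigma) (auto simp: split_def)
  moreover have "3 * (\<Sum>(i, j, k)\<in>?T. angle \<Phi> r i j k) = real (card ?T) * pi"
  proof -
    have rot: "(\<Sum>(i, j, k)\<in>?T. angle \<Phi> r j k i) = (\<Sum>(i, j, k)\<in>?T. angle \<Phi> r i j k)"
      by (rule sum.reindex_bij_witness[where j="\<lambda>(i, j, k). (j, k, i)" and i="\<lambda>(i, j, k). (k, i, j)"])
         (auto simp: insert_commute)
    have rot2: "(\<Sum>(i, j, k)\<in>?T. angle \<Phi> r k i j) = (\<Sum>(i, j, k)\<in>?T. angle \<Phi> r i j k)"
      by (rule sum.reindex_bij_witness[where i="\<lambda>(i, j, k). (j, k, i)" and j="\<lambda>(i, j, k). (k, i, j)"])
         (auto simp: insert_commute)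
    have "3 * (\<Sum>(i, j, k)\<in>?T. angle \<Phi> r i j k) =
        (\<Sum>(i, j, k)\<in>?T. angle \<Phi> r i j k + angle \<Phi> r j k i + angle \<Phi> r k i j)"
      using rot rot2 by (simp add: sum.distrib split_def)
    also have "\<dots> = (\<Sum>(i, j, k)\<in>?T. pi)"
    proof (rule sum.cong[OF refl], clarify)
      fix i j k assume f: "{i, j, k} \<in> F"
      then have f2: "{j, k, i} \<in> F" "{k, i, j} \<in> F" by (auto simp: insert_commute)
      have e: "{j, i} = {i, j}" "{k, i} = {i, k}" "{k, j} = {j, k}" by auto
      show "angle \<Phi> r i j k + angle \<Phi> r j k i + angle \<Phi> r k i j = pi"
        using circle_triple.corner_sum[OF triple[OF f r]]
        unfolding angle_eq_corner[OF triple[OF f r]] angle_eq_corner[OF triple[OF f2(1) r]]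
          angle_eq_corner[OF triple[OF f2(2) r]] e .
    qed
    finally show ?thesis by (simp add: split_def)
  qed
  moreover have "real (card ?T) = 6 * real (card F)" using card_ordered_faces by simp
  ultimately have "(\<Sum>i\<in>UNIV. \<Sum>(j, k) | {i, j, k} \<in> F. angle \<Phi> r i j k) = 2 * pi * real (card F)"
    by simp
  then have "(\<Sum>i\<in>UNIV. curvature F \<Phi> r $ i) = 2 * pi * real CARD('v) - pi * real (card F)"
    unfolding curvature_ordered_faces by (simp add: sum_subtractf sum_divide_distrib[symmetric])
  moreover have "real (card E) = 3 / 2 * real (card F)"
    using arg_cong[OF three_faces_two_edges, of real] by simp
  ultimately show ?thesis by (simp add: euler_characteristic_def algebra_simps)
qed

lemma curvature_bounded:
  assumes "circle_packing_metric r"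
  shows "\<bar>curvature F \<Phi> r $ i\<bar> \<le> 2 * pi + real CARD('v \<times> 'v) * pi"
proof -
  let ?P = "{(j, k). {i, j, k} \<in> F}"
  have a: "0 \<le> angle \<Phi> r i j k" "angle \<Phi> r i j k \<le> pi" if "{i, j, k} \<in> F" for j k
    using circle_triple.corner_range[OF triple[OF that assms]]
    by (auto simp: angle_eq_corner[OF triple[OF that assms]])
  have "0 \<le> (\<Sum>(j, k)\<in>?P. angle \<Phi> r i j k)" using a by (intro sum_nonneg) auto
  moreover have "(\<Sum>(j, k)\<in>?P. angle \<Phi> r i j k) \<le> real (card ?P) * pi"
    using a by (intro sum_bounded_above) auto
  moreover have "real (card ?P) * pi \<le> real CARD('v \<times> 'v) * pi"
    by (intro mult_right_mono of_nat_mono card_mono) auto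
  ultimately show ?thesis unfolding curvature_ordered_faces using pi_ge_zero by linarith
qed

lemma B_coeff_eq_conductance:
  assumes r: "circle_packing_metric r"
  shows "B_coeff F \<Phi> r i j = conductance r i j"
proof -
  define \<rho> where "\<rho> s = (\<chi> m. if m = j then s else r $ m)" for s
  have rpos: "r $ m > 0" for m using r by (simp add: circle_packing_metric_def)
  have "((\<lambda>s. angle \<Phi> (\<rho> s) i j k) has_real_derivative angle_weight r i j k / r $ j) (at (r $ j))"
    if f: "{i, j, k} \<in> F" for k
  proof -
    interpret circle_triple "r $ i" "r $ j" "r $ k" "cos (\<Phi> {i, j})" "cos (\<Phi> {i, k})" "cos (\<Phi> {j, k})"
      by (rule triple[OF f r])
    have d: "i \<noteq> j" "k \<noteq> j" using card_3_distinct[OF card_face[OF f]] by auto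
    have "((\<lambda>s. corner (r $ i) s (r $ k) (cos (\<Phi> {i, j})) (cos (\<Phi> {i, k})) (cos (\<Phi> {j, k}))) has_derivative
        (\<lambda>h. angle_weight r i j k * (h / r $ j - 0) + angle_weight r i k j * (0 - 0))) (at (r $ j))"
      using corner_has_derivative[of "\<lambda>_. r $ i" "\<lambda>_. 0" "r $ j" UNIV "\<lambda>s. s" "\<lambda>h. h / r $ j" "\<lambda>_. r $ k" "\<lambda>_. 0"] rpos[of j]
      by (simp add: angle_weight_def insert_commute)
    then have "((\<lambda>s. corner (r $ i) s (r $ k) (cos (\<Phi> {i, j})) (cos (\<Phi> {i, k})) (cos (\<Phi> {j, k}))) has_real_derivative
        angle_weight r i j k / r $ j) (at (r $ j))"
      by (rule has_derivative_imp_has_field_derivative) (simp add: mult.commute)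
    then show ?thesis
    proof (rule has_field_derivative_transform_within_open[where S="{0<..}"])
      fix s :: real assume s: "s \<in> {0<..}"
      have "circle_packing_metric (\<rho> s)" using s rpos by (simp add: \<rho>_def circle_packing_metric_def)
      then show "corner (r $ i) s (r $ k) (cos (\<Phi> {i, j})) (cos (\<Phi> {i, k})) (cos (\<Phi> {j, k})) = angle \<Phi> (\<rho> s) i j k"
        using angle_eq_corner[OF triple[OF f]] d by (simp add: \<rho>_def)
    qed (use rpos in auto)
  qed
  then have "((\<lambda>s. \<Sum>k | {i, j, k} \<in> F. angle \<Phi> (\<rho> s) i j k) has_real_derivative
      (\<Sum>k | {i, j, k} \<in> F. angle_weight r i j k / r $ j)) (at (r $ j))"
    by (intro DERIV_sum) auto
  then have "deriv (\<lambda>s. \<Sum>k | {i, j, k} \<in> F. angle \<Phi> (\<rho> s) i j k) (r $ j) = conductance r i j / r $ j"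
    by (simp add: DERIV_imp_deriv conductance_def sum_divide_distrib)
  then show ?thesis unfolding B_coeff_def \<rho>_def using rpos[of j] by simp
qed

end

locale calabi_flow = weighted_triangulation X E F \<Phi>
  for X :: "'a topology" and E F :: "'v::finite set set" and \<Phi> +
  fixes p :: real
  assumes p_gt_1: "p > 1"
begin

sublocale curvature_system "\<lambda>u. curvature F \<Phi> (exp_vec u)" "\<lambda>u. conductance (exp_vec u)" p
  "2 * pi * real_of_int (euler_characteristic E F) / real CARD('v)"
proof
  fix u :: "real^'v" and y :: "'v \<Rightarrow> real" and a b
  assume "\<And>i j. 0 < conductance (exp_vec u) i j \<Longrightarrow> y i = y j"
  then show "y a = y b" by (rule conductance_connected[OF circle_packing_exp_vec])
qed (use p_gt_1 conductance_sym conductance_nonneg conductance_continuous curvature_has_derivative sum_curvature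
      in \<open>auto\<close>)

lemma field_bounded: "\<exists>M. \<forall>u. norm (field u) \<le> M"
proof -
  define C where "C = 2 * pi + real CARD('v \<times> 'v) * pi"
  have "compact (signed_power p ` {-2 * C..2 * C})"
    by (intro compact_continuous_image continuous_on_subset[OF continuous_on_signed_power[OF p_gt_1]]) auto
  then obtain D where "\<forall>y\<in>signed_power p ` {-2 * C..2 * C}. norm y \<le> D"
    using compact_imp_bounded[of "signed_power p ` {-2 * C..2 * C}"] unfolding bounded_iff by blast
  then have D: "\<bar>signed_power p x\<bar> \<le> D" if "x \<in> {-2 * C..2 * C}" for x
    using that by simp
  have "norm (field u) \<le> (\<Sum>i\<in>(UNIV :: 'v set). \<Sum>j\<in>(UNIV :: 'v set). real CARD('v) * 5 * D)" for u
  proof -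
    have "\<bar>field u $ i\<bar> \<le> (\<Sum>j\<in>(UNIV :: 'v set). real CARD('v) * 5 * D)" for i
    proof -
      let ?K = "\<lambda>i. curvature F \<Phi> (exp_vec u) $ i"
      have "\<bar>field u $ i\<bar> \<le> (\<Sum>j\<in>UNIV. \<bar>conductance (exp_vec u) i j * signed_power p (?K j - ?K i)\<bar>)"
        unfolding field_def by (simp add: sum_abs)
      also have "\<dots> \<le> (\<Sum>j\<in>(UNIV :: 'v set). real CARD('v) * 5 * D)"
      proof (rule sum_mono)
        fix j
        have "\<bar>?K j\<bar> \<le> C" "\<bar>?K i\<bar> \<le> C" unfolding C_def by (intro curvature_bounded circle_packing_exp_vec)+
        then have "?K j - ?K i \<in> {-2 * C..2 * C}" by auto
        then show "\<bar>conductance (exp_vec u) i j * signed_power p (?K j - ?K i)\<bar> \<le> real CARD('v) * 5 * D"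
          unfolding abs_mult using D conductance_le[of "exp_vec u" i j] conductance_nonneg[of "exp_vec u" i j]
          by (intro mult_mono) auto
      qed
      finally show ?thesis .
    qed
    then have "(\<Sum>i\<in>UNIV. \<bar>field u $ i\<bar>) \<le> (\<Sum>i\<in>(UNIV :: 'v set). \<Sum>j\<in>(UNIV :: 'v set). real CARD('v) * 5 * D)"
      by (rule sum_mono)
    then show ?thesis using norm_le_l1_cart[of "field u"] by linarith
  qed
  then show ?thesis by blast
qed

lemma p_laplace_eq_field:
  "p_laplace p E F \<Phi> (exp_vec u) (curvature F \<Phi> (exp_vec u)) = field u"
proof -
  have "(\<Sum>j | {i, j} \<in> E. conductance (exp_vec u) i j * x j) = (\<Sum>j\<in>UNIV. conductance (exp_vec u) i j * x j)" for i x
    by (rule sum.mono_neutral_left) (auto simp: conductance_eq_0)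
  then show ?thesis
    by (simp add: p_laplace_def field_def vec_eq_iff B_coeff_eq_conductance signed_power_def)
qed

lemma flow_iff_log:
  assumes "\<And>t. t \<in> I \<Longrightarrow> circle_packing_metric (r t)"
  shows "p_calabi_flow p E F \<Phi> I r \<longleftrightarrow>
    (\<forall>t\<in>I. ((\<lambda>t. ln_vec (r t)) has_vector_derivative field (ln_vec (r t))) (at t within I))"
proof -
  have "(r has_vector_derivative (\<chi> i. p_laplace p E F \<Phi> (r t) (curvature F \<Phi> (r t)) $ i * r t $ i)) (at t within I) \<longleftrightarrow>
      ((\<lambda>t. ln_vec (r t)) has_vector_derivative field (ln_vec (r t))) (at t within I)" if t: "t \<in> I" for t
  proof -
    have pos: "r s $ i > 0" if "s \<in> I" for s i using assms[OF that] by (simp add: circle_packing_metric_def)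
    have lap: "p_laplace p E F \<Phi> (r t) (curvature F \<Phi> (r t)) = field (ln_vec (r t))"
      using p_laplace_eq_field[of "ln_vec (r t)"] by (simp add: exp_ln_vec assms t)
    have "((\<lambda>t. r t $ i) has_real_derivative c * r t $ i) (at t within I) \<longleftrightarrow>
        ((\<lambda>t. ln (r t $ i)) has_real_derivative c) (at t within I)" for i c
    proof
      assume "((\<lambda>t. r t $ i) has_real_derivative c * r t $ i) (at t within I)"
      from DERIV_chain2[OF DERIV_ln[OF pos[OF t]] this]
      show "((\<lambda>t. ln (r t $ i)) has_real_derivative c) (at t within I)"
        using less_imp_neq[OF pos[OF t, of i]] by (simp add: field_simps)
    next
      assume "((\<lambda>t. ln (r t $ i)) has_real_derivative c) (at t within I)"
      from DERIV_chain2[OF DERIV_exp this]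
      have "((\<lambda>t. exp (ln (r t $ i))) has_real_derivative c * r t $ i) (at t within I)"
        using pos[OF t, of i] by (simp add: mult.commute)
      then show "((\<lambda>t. r t $ i) has_real_derivative c * r t $ i) (at t within I)"
        by (rule has_field_derivative_transform_within[OF _ zero_less_one t]) (use pos in auto)
    qed
    then show ?thesis unfolding has_vector_derivative_vec_iff lap by simp
  qed
  then show ?thesis using assms unfolding p_calabi_flow_def by blast
qed

lemma flow_exp_vec:
  "(\<forall>t\<in>I. (u has_vector_derivative field (u t)) (at t within I)) \<Longrightarrow> p_calabi_flow p E F \<Phi> I (\<lambda>t. exp_vec (u t))"
  by (subst flow_iff_log) (simp_all add: ln_exp_vec)

text \<open>
  Scaling all radii does not change the curvature: the graph Laplacian kills constants.
\<close>

lemma curvature_shift: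
  "curvature F \<Phi> (exp_vec (u + (\<chi> i. c))) $ i = curvature F \<Phi> (exp_vec u) $ i"
proof -
  have "((\<lambda>t. u + t *\<^sub>R (\<chi> i. c)) has_vector_derivative (\<chi> i. c)) (at t)" for t
    by (auto intro!: derivative_eq_intros)
  from K_curve_deriv[OF this]
  have "((\<lambda>t. curvature F \<Phi> (exp_vec (u + t *\<^sub>R (\<chi> i. c))) $ i) has_real_derivative 0) (at t)" for t by simp
  then have "curvature F \<Phi> (exp_vec (u + 1 *\<^sub>R (\<chi> i. c))) $ i = curvature F \<Phi> (exp_vec (u + 0 *\<^sub>R (\<chi> i. c))) $ i"
    by (intro DERIV_isconst_all[of "\<lambda>t. curvature F \<Phi> (exp_vec (u + t *\<^sub>R (\<chi> i. c))) $ i"]) blast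
  then show ?thesis by simp
qed

end

section \<open>Long-time existence and convergence\<close>

theorem theorem1p4:
  fixes X :: "'a topology"
    and E F :: "'v::finite set set"
    and \<Phi> :: "'v set \<Rightarrow> real"
    and p :: real
    and r0 :: "real^'v"
  assumes "p > 1"
    and "closed_surface X" and "connected_space X"
    and "triangulation_of X E F"
    and "\<forall>e\<in>E. 0 \<le> \<Phi> e \<and> \<Phi> e \<le> pi / 2"
    and "circle_packing_metric r0"
    and "(\<Prod>i\<in>UNIV. r0 $ i) = 1"
  shows "(\<exists>r. p_calabi_flow p E F \<Phi> {0..} r \<and> r 0 = r0) \<and>
    (\<forall>T>0. \<forall>\<rho>. p_calabi_flow p E F \<Phi> {0..<T} \<rho> \<and> \<rho> 0 = r0 \<longrightarrow>
        (\<exists>r. p_calabi_flow p E F \<Phi> {0..} r \<and> (\<forall>t\<in>{0..<T}. r t = \<rho> t))) \<and>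
    (\<forall>r. p_calabi_flow p E F \<Phi> {0..} r \<and> r 0 = r0 \<longrightarrow>
        ((\<exists>L. circle_packing_metric L \<and> (r \<longlongrightarrow> L) at_top) \<longleftrightarrow>
         (\<exists>r_av. constant_curvature_metric E F \<Phi> r_av)))"
proof -
  interpret calabi_flow X E F \<Phi> p
    using assms(1-5) by unfold_locales auto
  obtain M where M: "\<And>u. norm (field u) \<le> M" using field_bounded by blast
  show ?thesis
  proof (intro conjI allI impI)
    obtain u where u: "u 0 = ln_vec r0" "\<And>t. t \<ge> 0 \<Longrightarrow> (u has_vector_derivative field (u t)) (at t within {0..})"
      using peano_existence_bounded[OF field_continuous M, of "ln_vec r0"] by blast
    then have "p_calabi_flow p E F \<Phi> {0..} (\<lambda>t. exp_vec (u t))" by (intro flow_exp_vec) simp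
    moreover have "exp_vec (u 0) = r0" using u(1) assms(6) by (simp add: exp_ln_vec)
    ultimately show "\<exists>r. p_calabi_flow p E F \<Phi> {0..} r \<and> r 0 = r0"
      by (intro exI[of _ "\<lambda>t. exp_vec (u t)"]) simp
  next
    fix T :: real and \<rho> :: "real \<Rightarrow> real^'v"
    assume T: "T > 0" and "p_calabi_flow p E F \<Phi> {0..<T} \<rho> \<and> \<rho> 0 = r0"
    then have \<rho>: "p_calabi_flow p E F \<Phi> {0..<T} \<rho>" by simp
    then have pos: "circle_packing_metric (\<rho> t)" if "t \<in> {0..<T}" for t using that by (simp add: p_calabi_flow_def)
    have "((\<lambda>t. ln_vec (\<rho> t)) has_vector_derivative field (ln_vec (\<rho> t))) (at t within {0..<T})" if "t \<in> {0..<T}" for t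
      using flow_iff_log[of "{0..<T}" \<rho>, OF pos] \<rho> that by simp
    from ode_continuation[OF field_continuous M T this]
    obtain u where u: "\<And>t. t \<in> {0..<T} \<Longrightarrow> u t = ln_vec (\<rho> t)"
      "\<And>t. t \<ge> 0 \<Longrightarrow> (u has_vector_derivative field (u t)) (at t within {0..})"
      by blast
    then have "p_calabi_flow p E F \<Phi> {0..} (\<lambda>t. exp_vec (u t))" by (intro flow_exp_vec) simp
    moreover have "exp_vec (u t) = \<rho> t" if "t \<in> {0..<T}" for t
      using u(1)[OF that] pos[OF that] by (simp add: exp_ln_vec)
    ultimately show "\<exists>r. p_calabi_flow p E F \<Phi> {0..} r \<and> (\<forall>t\<in>{0..<T}. r t = \<rho> t)"
      by (intro exI[of _ "\<lambda>t. exp_vec (u t)"]) simp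
  next
    fix r assume "p_calabi_flow p E F \<Phi> {0..} r \<and> r 0 = r0"
    then have r: "p_calabi_flow p E F \<Phi> {0..} r" and r00: "r 0 = r0" by auto
    have pos: "circle_packing_metric (r t)" if "t \<in> {0..}" for t using that r by (simp add: p_calabi_flow_def)
    have sol: "((\<lambda>t. ln_vec (r t)) has_vector_derivative field (ln_vec (r t))) (at t within {0..})" if "t \<ge> 0" for t
      using flow_iff_log[of "{0..}" r, OF pos] r that by simp
    show "(\<exists>L. circle_packing_metric L \<and> (r \<longlongrightarrow> L) at_top) \<longleftrightarrow> (\<exists>r_av. constant_curvature_metric E F \<Phi> r_av)"
    proof
      assume "\<exists>L. circle_packing_metric L \<and> (r \<longlongrightarrow> L) at_top"
      then obtain L where L: "circle_packing_metric L" "(r \<longlongrightarrow> L) at_top" by blast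
      from limit_has_constant_curvature[OF sol tendsto_ln_vec[OF L(2,1)]]
      have "constant_curvature_metric E F \<Phi> L"
        using L(1) by (simp add: constant_curvature_metric_def exp_ln_vec)
      then show "\<exists>r_av. constant_curvature_metric E F \<Phi> r_av" by blast
    next
      assume "\<exists>r_av. constant_curvature_metric E F \<Phi> r_av"
      then obtain r_av where r_av: "constant_curvature_metric E F \<Phi> r_av" by blast
      \<comment> \<open>Rescaling \<open>r_av\<close> puts it on the hyperplane of coordinate sum \<open>0\<close> that contains the solution.\<close>
      define m where "m = (\<Sum>i\<in>UNIV. ln (r_av $ i)) / real CARD('v)"
      define c where "c = ln_vec r_av + (\<chi> i. - m)"
      have "curvature F \<Phi> (exp_vec c) $ i = 2 * pi * real_of_int (euler_characteristic E F) / real CARD('v)" for i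
        unfolding c_def curvature_shift using r_av by (simp add: constant_curvature_metric_def exp_ln_vec)
      moreover have "(\<Sum>i\<in>UNIV. c $ i) = 0"
        by (simp add: c_def sum_subtractf m_def)
      moreover have "(\<Sum>i\<in>UNIV. ln_vec (r 0) $ i) = 0"
      proof -
        have "r0 $ i \<noteq> 0" for i using assms(6) less_imp_neq unfolding circle_packing_metric_def by metis
        then show ?thesis using ln_prod[of UNIV "\<lambda>i. r0 $ i"] assms(7) by (simp add: r00)
      qed
      ultimately have "((\<lambda>t. ln_vec (r t)) \<longlongrightarrow> c) at_top"
        by (intro converges_to_constant_curvature[OF sol]) auto
      then have "((\<lambda>t. exp_vec (ln_vec (r t))) \<longlongrightarrow> exp_vec c) at_top" by (rule tendsto_exp_vec)
      then have "(r \<longlongrightarrow> exp_vec c) at_top"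
        by (rule Lim_transform_eventually)
           (use eventually_ge_at_top[of 0] in eventually_elim, simp add: exp_ln_vec pos)
      then show "\<exists>L. circle_packing_metric L \<and> (r \<longlongrightarrow> L) at_top" by (blast intro: circle_packing_exp_vec)
    qed
  qed
qed

end
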